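(* Let $k\ge 3$ and let $n_1,\dots,n_r\ge 2$ be integers such that at least six of the $n_i$ are odd. For each $1\le i\le r$ let $\mathcal{F}^1_i,\dots,\mathcal{F}^k_i$ be pairwise almost orthogonal symmetric chain decompositions of $Q_{n_i}$, and suppose that the collection $\{\mathcal{F}^j_i\}_{j=1}^k$ is good whenever $n_i$ is even. Then there exist $k$ pairwise almost orthogonal symmetric chain decompositions $\mathcal{H}^1,\dots,\mathcal{H}^k$ of $Q_{n_1+\cdots+n_r}$ such that for each $j$, every chain of $\mathcal{H}^j$ is contained in a cuboid $A_1\times\cdots\times A_r$ with $A_i\in\mathcal{F}^j_i$ for all $i$.
   Context: $Q_n$ denotes the Boolean lattice of subsets of $[n]=\{1,\dots,n\}$ under inclusion. We identify $Q_{n_1}\times\cdots\times Q_{n_r}$ (product order) with $Q_{n_1+\cdots+n_r}$ by splitting $[n_1+\cdots+n_r]$ into consecutive blocks of sizes $n_1,\dots,n_r$. A symmetric chain in $Q_n$ consists of exactly one subset of each size $j,j+1,\dots,n-j$ for some $j$; a symmetric chain decomposition (SCD) is a partition of $Q_n$ into symmetric chains. Two SCDs $\mathcal{F},\mathcal{G}$ of $Q_n$ are almost orthogonal if for all chains $A\in\mathcal{F}$, $B\in\mathcal{G}$, $|A\cap B|\le1$, except when $A$ and $B$ both contain $\varnothing$ and $[n]$, in which case $|A\cap B|=2$. A collection $\{\mathcal{F}^j\}$ of pairwise almost orthogonal SCDs of $Q_n$ with $n$ even is good if the $1$-element chains occurring in the different $\mathcal{F}^j$ are pairwise distinct (no $1$-element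 chain belongs to two different $\mathcal{F}^j$). *)

theory Defs
  imports Main "HOL-Library.Disjoint_Sets"
begin

definition boolean_lattice :: "nat \<Rightarrow> nat set set" where
  "boolean_lattice n = Pow {1..n}"

definition symmetric_chain :: "nat \<Rightarrow> nat set set \<Rightarrow> bool" where
  "symmetric_chain n C \<longleftrightarrow>
     subset.chain (boolean_lattice n) C \<and> (\<exists>j. 2 * j \<le> n \<and> bij_betw card C {j..n - j})"

definition scd :: "nat \<Rightarrow> nat set set set \<Rightarrow> bool" where
  "scd n \<F> \<longleftrightarrow> partition_on (boolean_lattice n) \<F> \<and> (\<forall>C\<in>\<F>. symmetric_chain n C)"

definition almost_orthogonal :: "nat \<Rightarrow> nat set set set \<Rightarrow> nat set set set \<Rightarrow> bool" where
  "almost_orthogonal n \<F> \<G> \<longleftrightarrow>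
     (\<forall>A\<in>\<F>. \<forall>B\<in>\<G>.
        if {} \<in> A \<and> {1..n} \<in> A \<and> {} \<in> B \<and> {1..n} \<in> B
        then card (A \<inter> B) = 2 else card (A \<inter> B) \<le> 1)"

definition pairwise_almost_orthogonal_scds ::
    "nat \<Rightarrow> nat \<Rightarrow> (nat \<Rightarrow> nat set set set) \<Rightarrow> bool" where
  "pairwise_almost_orthogonal_scds n k \<F> \<longleftrightarrow>
     (\<forall>j\<in>{1..k}. scd n (\<F> j)) \<and>
     pairwise (\<lambda>j j'. almost_orthogonal n (\<F> j) (\<F> j')) {1..k}"

text \<open>Goodness is only used for even \<open>n\<close> and for families that are already known to be
  pairwise almost orthogonal, so the definition records just the condition on 1-element chains.\<close>

definition good :: "nat \<Rightarrow> (nat \<Rightarrow> nat set set set) \<Rightarrow> bool" where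
  "good k \<F> \<longleftrightarrow> pairwise (\<lambda>j j'. \<not> (\<exists>A. card A = 1 \<and> A \<in> \<F> j \<and> A \<in> \<F> j')) {1..k}"

text \<open>The \<open>i\<close>-th of the consecutive blocks of sizes \<open>n 1\<close>, \<open>n 2\<close> and so on consists of the integers
  \<open>(\<Sum>l\<in>{1..<i}. n l) + x\<close> with \<open>x \<in> {1..n i}\<close>; a subset \<open>X\<close> of the ground set corresponds to
  the tuple whose \<open>i\<close>-th coordinate is \<open>block n i X\<close>.\<close>

definition block :: "(nat \<Rightarrow> nat) \<Rightarrow> nat \<Rightarrow> nat set \<Rightarrow> nat set" where
  "block n i X = {x \<in> {1..n i}. (\<Sum>l\<in>{1..<i}. n l) + x \<in> X}"

definition cuboid :: "nat \<Rightarrow> (nat \<Rightarrow> nat) \<Rightarrow> (nat \<Rightarrow> nat set set) \<Rightarrow> nat set set" where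
  "cuboid r n A =
     {X \<in> boolean_lattice (\<Sum>i\<in>{1..r}. n i). \<forall>i\<in>{1..r}. block n i X \<in> A i}"

end

theory Submission
  imports Defs "HOL-Library.FuncSet" "HOL-Library.Product_Order"
begin

text \<open>Parametrising the chains \<open>A\<^sub>i\<close>, a cuboid becomes a box \<open>\<Prod> {0..a\<^sub>i}\<close>. Chains from cuboids of two different
  families can share points \<open>p < q\<close> only if \<open>q\<close> arises from \<open>p\<close> by raising some coordinates from \<open>0\<close> to
  \<open>a\<^sub>i = n\<^sub>i \<ge> 2\<close>. Goodness excludes that the remaining coordinates all have \<open>a\<^sub>i = 0\<close>, unless there are none, so it
  suffices to decompose every box into symmetric chains containing no such pair, except for the pair of
  the endpoints of the box.

  Call \<open>P\<close> absorbing if \<open>{0..c} \<times> P\<close> has such a decomposition for every \<open>c\<close>. Decomposing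
  \<open>{0..c} \<times> {0..a}\<close> by zigzags, where only the longest chain contains a forbidden pair, namely its endpoints,
  shows that \<open>P \<times> {0..a}\<close> is absorbing as well. Hence one absorbing sub-box is enough. If five of the \<open>a\<^sub>i\<close> are
  \<open>1\<close>, take the cube \<open>{0,1}\<^sup>5\<close>. Otherwise two of them are odd and at least \<open>3\<close>, say \<open>a\<close> and \<open>b\<close>, and
  \<open>{0..a} \<times> {0..b}\<close> is absorbing up to one long chain; multiplying by a further \<open>{0,1}\<close> makes it absorbing,
  and if no \<open>a\<^sub>i\<close> is \<open>1\<close> then the exceptional long chain is harmless.\<close>

section \<open>Saturated chains and decompositions avoiding bad pairs\<close>

text \<open>What shapes the proof is that a two-element factor cannot be treated like the others.
  For \<open>c \<ge> 2\<close> the grid \<open>{..c} \<times> {..1}\<close> has no decomposition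
  without bad pairs. Its chain of ranks \<open>0\<close> to \<open>c + 1\<close> changes rows at
  some \<open>x\<close>. If \<open>0 < x < c\<close>, the other chain would have to contain the
  leftover points \<open>(0, 1)\<close> and \<open>(c, 0)\<close>, which are incomparable; if
  \<open>x\<close> is \<open>0\<close> or \<open>c\<close>, a full row lies in one chain. Longer
  factors admit zigzags, but a chain of full length always joins opposite corners, so one bad pair
  survives and has to be broken up by means of further coordinates. That is what absorption
  provides. Parity enters because the chain lengths \<open>a i\<close> have the parity of
  \<open>n i\<close>: a factor with odd \<open>n i\<close> never degenerates to a point, and if at
  most four of six odd lengths equal \<open>1\<close>, two are at least \<open>3\<close>.\<close>

definition saturated :: "('a::order \<Rightarrow> nat) \<Rightarrow> 'a \<Rightarrow> 'a \<Rightarrow> 'a set \<Rightarrow> bool" where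
  "saturated rk p q C \<longleftrightarrow> (\<exists>f n. C = f ` {..n} \<and> f 0 = p \<and> f n = q \<and>
     (\<forall>x\<le>n. rk (f x) = rk p + x) \<and> (\<forall>x y. x \<le> y \<longrightarrow> y \<le> n \<longrightarrow> f x \<le> f y))"

definition symchain :: "('a::order \<Rightarrow> nat) \<Rightarrow> nat \<Rightarrow> 'a set \<Rightarrow> bool" where
  "symchain rk N C \<longleftrightarrow> (\<exists>p q. saturated rk p q C \<and> rk p + rk q = N)"

text \<open>\<open>P\<close> may be any subset of an ordered set and \<open>rk\<close> any function
  on it. Pieces of a larger set can be decomposed separately as long as they share \<open>N\<close>,
  twice the middle rank.\<close>

definition sdec :: "('a::order \<Rightarrow> nat) \<Rightarrow> nat \<Rightarrow> ('a \<Rightarrow> 'a \<Rightarrow> bool) \<Rightarrow> 'a set \<Rightarrow> bool" where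
  "sdec rk N B P \<longleftrightarrow> (\<exists>\<C>. partition_on P \<C> \<and>
     (\<forall>C\<in>\<C>. symchain rk N C \<and> (\<forall>x\<in>C. \<forall>y\<in>C. \<not> B x y)))"

lemma saturated_le:
  assumes "saturated rk p q C"
  shows "p \<le> q" "rk p \<le> rk q" "p \<in> C" "q \<in> C"
proof -
  obtain f n where f: "C = f ` {..n}" "f 0 = p" "f n = q" "\<forall>x\<le>n. rk (f x) = rk p + x"
     "\<forall>x y. x \<le> y \<longrightarrow> y \<le> n \<longrightarrow> f x \<le> f y" using assms unfolding saturated_def by blast
  show "p \<le> q" using f(2,3,5) le0[of n] by blast
  show "rk p \<le> rk q" using f(3,4) by (metis le_add1 le_refl)
  show "p \<in> C" "q \<in> C" using f(1,2,3) by auto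
qed

lemma symchainI: "saturated rk p q C \<Longrightarrow> rk p + rk q = N \<Longrightarrow> C' = C \<Longrightarrow> symchain rk N C'"
  by (auto simp: symchain_def)

lemma saturated_single: "saturated rk p p {p}"
  unfolding saturated_def by (rule exI[of _ "\<lambda>_. p"], rule exI[of _ 0]) auto

lemma saturated_append:
  assumes C: "saturated rk p q C" and D: "saturated rk p' q' D"
    and "q \<le> p'" "rk p' = Suc (rk q)"
  shows "saturated rk p q' (C \<union> D)"
proof -
  obtain f n where f: "C = f ` {..n}" "f 0 = p" "f n = q" "\<forall>x\<le>n. rk (f x) = rk p + x"
     "\<forall>x y. x \<le> y \<longrightarrow> y \<le> n \<longrightarrow> f x \<le> f y" using C unfolding saturated_def by blast
  obtain g m where g: "D = g ` {..m}" "g 0 = p'" "g m = q'" "\<forall>x\<le>m. rk (g x) = rk p' + x"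
     "\<forall>x y. x \<le> y \<longrightarrow> y \<le> m \<longrightarrow> g x \<le> g y" using D unfolding saturated_def by blast
  define h where "h x = (if x \<le> n then f x else g (x - Suc n))" for x
  have "rk q = rk p + n" using f by auto
  have im: "C \<union> D = h ` {..Suc (n + m)}"
  proof (intro equalityI subsetI)
    fix x assume "x \<in> C \<union> D"
    then consider i where "i \<le> n" "x = f i" | i where "i \<le> m" "x = g i" using f g by auto
    then show "x \<in> h ` {..Suc (n + m)}"
    proof cases
      case 1 then show ?thesis by (intro image_eqI[of _ _ i]) (auto simp: h_def)
    next
      case 2 then show ?thesis by (intro image_eqI[of _ _ "Suc n + i"]) (auto simp: h_def)
    qed
  qed (auto simp: h_def f g)
  have mono: "h x \<le> h y" if xy: "x \<le> y" "y \<le> Suc (n + m)" for x y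
  proof -
    consider "y \<le> n" | "x \<le> n" "\<not> y \<le> n" | "\<not> x \<le> n" using xy by linarith
    then show ?thesis
    proof cases
      case 2
      have "f x \<le> q" using f 2 by auto
      moreover have "p' \<le> g (y - Suc n)" using g xy by force
      ultimately show ?thesis using 2 assms(3) by (auto simp: h_def)
    qed (use f g xy in \<open>auto simp: h_def\<close>)
  qed
  have rkh: "rk (h x) = rk p + x" if "x \<le> Suc (n + m)" for x
    using f g that assms(4) \<open>rk q = rk p + n\<close> by (auto simp: h_def)
  show ?thesis unfolding saturated_def
    by (rule exI[of _ h], rule exI[of _ "Suc (n + m)"]) (use im mono rkh f g in \<open>auto simp: h_def\<close>)
qed

lemma saturated_image:
  assumes "saturated rk p q C"
    and "\<And>x y. x \<in> C \<Longrightarrow> y \<in> C \<Longrightarrow> x \<le> y \<Longrightarrow> \<phi> x \<le> \<phi> y"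
    and "\<And>x. x \<in> C \<Longrightarrow> rk' (\<phi> x) = rk x + s"
  shows "saturated rk' (\<phi> p) (\<phi> q) (\<phi> ` C)"
proof -
  obtain f n where f: "C = f ` {..n}" "f 0 = p" "f n = q" "\<forall>x\<le>n. rk (f x) = rk p + x"
     "\<forall>x y. x \<le> y \<longrightarrow> y \<le> n \<longrightarrow> f x \<le> f y" using assms(1) unfolding saturated_def by blast
  have inC: "f x \<in> C" if "x \<le> n" for x unfolding f(1) using that by blast
  show ?thesis unfolding saturated_def
  proof (intro exI[of _ "\<lambda>x. \<phi> (f x)"] exI[of _ n] conjI allI impI)
    show "\<phi> ` C = (\<lambda>x. \<phi> (f x)) ` {..n}" unfolding f(1) by (rule image_image)
    show "\<phi> (f 0) = \<phi> p" "\<phi> (f n) = \<phi> q" by (simp_all only: f(2,3))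
    show "rk' (\<phi> (f x)) = rk' (\<phi> p) + x" if "x \<le> n" for x
    proof -
      have "p \<in> C" using inC[of 0] by (simp add: f(2))
      then have "rk' (\<phi> p) = rk p + s" by (rule assms(3))
      moreover have "rk' (\<phi> (f x)) = rk (f x) + s" by (rule assms(3)[OF inC[OF that]])
      ultimately show ?thesis using f(4) that by simp
    qed
    show "\<phi> (f x) \<le> \<phi> (f y)" if "x \<le> y" "y \<le> n" for x y
      using that f(5) by (intro assms(2) inC) auto
  qed
qed

lemma symchain_image:
  assumes "symchain rk N C"
    and "\<And>x y. x \<in> C \<Longrightarrow> y \<in> C \<Longrightarrow> x \<le> y \<Longrightarrow> \<phi> x \<le> \<phi> y"
    and "\<And>x. x \<in> C \<Longrightarrow> rk' (\<phi> x) = rk x + s"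
    and "N' = N + 2 * s"
  shows "symchain rk' N' (\<phi> ` C)"
proof -
  obtain p q where pq: "saturated rk p q C" "rk p + rk q = N"
    using assms(1) by (auto simp: symchain_def)
  have "saturated rk' (\<phi> p) (\<phi> q) (\<phi> ` C)" by (rule saturated_image[OF pq(1) assms(2,3)])
  moreover have "rk' (\<phi> p) + rk' (\<phi> q) = N'"
    using saturated_le[OF pq(1)] assms(3,4) pq by auto
  ultimately show ?thesis by (auto simp: symchain_def)
qed

lemma symchain_param:
  assumes "symchain rk N C"
  shows "\<exists>f n j. C = f ` {..n} \<and> N = 2 * j + n \<and> (\<forall>x\<le>n. rk (f x) = j + x) \<and>
    (\<forall>x y. x \<le> y \<longrightarrow> y \<le> n \<longrightarrow> f x \<le> f y) \<and> inj_on f {..n}"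
proof -
  obtain p q f n where f: "C = f ` {..n}" "f 0 = p" "f n = q" "\<forall>x\<le>n. rk (f x) = rk p + x"
     "\<forall>x y. x \<le> y \<longrightarrow> y \<le> n \<longrightarrow> f x \<le> f y" "rk p + rk q = N"
    using assms unfolding symchain_def saturated_def by blast
  have "inj_on f {..n}" using f(4) by (intro inj_onI) (metis add_left_cancel atMost_iff)
  moreover have "N = 2 * rk p + n" using f(3,4,6) by (metis add.assoc le_refl mult_2)
  ultimately show ?thesis using f(1,4,5) by blast
qed

lemma sdec_single: "symchain rk N C \<Longrightarrow> \<forall>x\<in>C. \<forall>y\<in>C. \<not> B x y \<Longrightarrow> sdec rk N B C"
  unfolding sdec_def
  by (rule exI[of _ "{C}"]) (auto simp: symchain_def partition_on_def disjoint_def dest: saturated_le(3))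

lemma sdec_empty: "sdec rk N B {}"
  unfolding sdec_def by (rule exI[of _ "{}"]) (auto simp: partition_on_def)

text \<open>Chains only need \<open>\<phi>\<close> to preserve the order, so the image may have more
  comparable pairs than \<open>P\<close>. A rank shift by \<open>s\<close> moves both ends of each
  chain, which accounts for \<open>2 * s\<close>.\<close>

lemma sdec_image:
  assumes "sdec rk N B P" "inj_on \<phi> P"
    and "\<And>x y. x \<in> P \<Longrightarrow> y \<in> P \<Longrightarrow> x \<le> y \<Longrightarrow> \<phi> x \<le> \<phi> y"
    and "\<And>x. x \<in> P \<Longrightarrow> rk' (\<phi> x) = rk x + s"
    and "N' = N + 2 * s"
    and "\<And>x y. x \<in> P \<Longrightarrow> y \<in> P \<Longrightarrow> B' (\<phi> x) (\<phi> y) \<Longrightarrow> B x y"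
    and "P' = \<phi> ` P"
  shows "sdec rk' N' B' P'"
proof -
  obtain \<C> where \<C>': "partition_on P \<C>"
    "\<forall>C\<in>\<C>. symchain rk N C \<and> (\<forall>x\<in>C. \<forall>y\<in>C. \<not> B x y)"
    using assms(1) unfolding sdec_def by blast
  have \<C>: "partition_on P \<C>" "\<And>C. C \<in> \<C> \<Longrightarrow> symchain rk N C"
    "\<And>C x y. C \<in> \<C> \<Longrightarrow> x \<in> C \<Longrightarrow> y \<in> C \<Longrightarrow> \<not> B x y"
    using \<C>' by simp_all
  have sub: "\<And>C. C \<in> \<C> \<Longrightarrow> C \<subseteq> P" using \<C>(1) by (auto simp: partition_on_def)
  have emp: "{} \<notin> (`) \<phi> ` \<C>" using \<C>(1) by (auto simp: partition_on_def)
  have part: "partition_on P' ((`) \<phi> ` \<C>)"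
    using partition_on_inj_image[OF \<C>(1) assms(2)] emp assms(7) by auto
  show ?thesis unfolding sdec_def
  proof (intro exI[of _ "(`) \<phi> ` \<C>"] conjI part ballI)
    fix D assume "D \<in> (`) \<phi> ` \<C>"
    then obtain C where C: "C \<in> \<C>" "D = \<phi> ` C" by auto
    show "symchain rk' N' D" unfolding C(2)
    proof (rule symchain_image[OF \<C>(2)[OF C(1)]])
      show "\<phi> x \<le> \<phi> y" if "x \<in> C" "y \<in> C" "x \<le> y" for x y
        using that sub[OF C(1)] by (intro assms(3)) auto
      show "rk' (\<phi> x) = rk x + s" if "x \<in> C" for x
        using that sub[OF C(1)] by (intro assms(4)) auto
    qed (fact assms(5))
    show "\<not> B' x y" if "x \<in> D" "y \<in> D" for x y
    proof -
      obtain u v where uv: "u \<in> C" "v \<in> C" "x = \<phi> u" "y = \<phi> v"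
        using \<open>x \<in> D\<close> \<open>y \<in> D\<close> C(2) by auto
      then show ?thesis using \<C>(3)[OF C(1) uv(1,2)] assms(6)[of u v] sub[OF C(1)] by auto
    qed
  qed
qed

lemma sdec_partition:
  assumes "partition_on P \<Q>" "\<And>Q. Q \<in> \<Q> \<Longrightarrow> sdec rk N B Q"
  shows "sdec rk N B P"
proof -
  define R where "R Q \<C> \<longleftrightarrow> partition_on Q \<C> \<and>
     (\<forall>C\<in>\<C>. symchain rk N C \<and> (\<forall>x\<in>C. \<forall>y\<in>C. \<not> B x y))" for Q \<C>
  define F where "F Q = (SOME \<C>. R Q \<C>)" for Q
  have "R Q (F Q)" if "Q \<in> \<Q>" for Q
    using assms(2)[OF that] someI_ex[of "R Q"] by (simp add: sdec_def R_def F_def)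
  then have F': "\<forall>Q\<in>\<Q>. partition_on Q (F Q) \<and>
     (\<forall>C\<in>F Q. symchain rk N C \<and> (\<forall>x\<in>C. \<forall>y\<in>C. \<not> B x y))"
    by (simp add: R_def)
  have F: "\<And>Q. Q \<in> \<Q> \<Longrightarrow> partition_on Q (F Q)" using F' by simp
  have F2: "\<forall>C\<in>(\<Union>Q\<in>\<Q>. F Q). symchain rk N C \<and> (\<forall>x\<in>C. \<forall>y\<in>C. \<not> B x y)"
    using F' by simp
  have "partition_on P (\<Union>Q\<in>\<Q>. F Q)"
  proof (rule partition_onI)
    have "\<Union> (\<Union>Q\<in>\<Q>. F Q) = (\<Union>Q\<in>\<Q>. \<Union> (F Q))" by blast
    also have "\<dots> = P"
      using assms(1) F by (simp add: partition_on_def)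
    finally show "\<Union> (\<Union>Q\<in>\<Q>. F Q) = P" .
    show "{} \<notin> (\<Union>Q\<in>\<Q>. F Q)" using F by (auto simp: partition_on_def)
    fix C D assume "C \<in> (\<Union>Q\<in>\<Q>. F Q)" "D \<in> (\<Union>Q\<in>\<Q>. F Q)" "C \<noteq> D"
    then obtain Q R where QR: "Q \<in> \<Q>" "R \<in> \<Q>" "C \<in> F Q" "D \<in> F R" by auto
    have s: "C \<subseteq> Q" "D \<subseteq> R" using F[OF QR(1)] F[OF QR(2)] QR(3,4)
      by (auto simp: partition_on_def)
    show "disjnt C D"
    proof (cases "Q = R")
      case True
      then show ?thesis using F[OF QR(1)] QR \<open>C \<noteq> D\<close>
        by (auto simp: partition_on_def disjnt_def disjoint_def)
    next
      case False
      then have "Q \<inter> R = {}" using assms(1) QR by (auto simp: partition_on_def disjoint_def)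
      then show ?thesis using s by (auto simp: disjnt_def)
    qed
  qed
  then show ?thesis unfolding sdec_def using F2 by (intro exI conjI)
qed

lemma sdec_Un:
  assumes "sdec rk N B P" "sdec rk N B Q" "P \<inter> Q = {}"
  shows "sdec rk N B (P \<union> Q)"
proof (rule sdec_partition)
  show "partition_on (P \<union> Q) ({P, Q} - {{}})"
    using assms(3) by (auto simp: partition_on_def disjoint_def)
qed (use assms in auto)

lemma sdec_Un':
  assumes "sdec rk N B P" "sdec rk N B Q" "P \<inter> Q = {}" "S = P \<union> Q"
  shows "sdec rk N B S"
  using sdec_Un assms by blast

section \<open>Products\<close>

text \<open>Only equality in both coordinates is left out of the combinations, so iterated products
  yield pairs that are bad in a nonempty set of coordinates and equal in the others.\<close>

definition prodbad :: "('a \<Rightarrow> 'a \<Rightarrow> bool) \<Rightarrow> ('b \<Rightarrow> 'b \<Rightarrow> bool) \<Rightarrow> 'a \<times> 'b \<Rightarrow> 'a \<times> 'b \<Rightarrow> bool" where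
  "prodbad B B' x y \<longleftrightarrow> fst x = fst y \<and> B' (snd x) (snd y) \<or> B (fst x) (fst y) \<and> snd x = snd y \<or>
     B (fst x) (fst y) \<and> B' (snd x) (snd y)"

definition prodrk :: "('a \<Rightarrow> nat) \<Rightarrow> ('b \<Rightarrow> nat) \<Rightarrow> 'a \<times> 'b \<Rightarrow> nat" where
  "prodrk r s x = r (fst x) + s (snd x)"

text \<open>Two shared points can differ in a block only as the empty set and the full block. The
  chain of that block then has \<open>n i + 1 \<ge> 3\<close> elements, so shorter chains have no
  bad pair.\<close>

definition fullbad :: "nat \<Rightarrow> nat \<Rightarrow> nat \<Rightarrow> bool" where
  "fullbad c x y \<longleftrightarrow> 2 \<le> c \<and> x = 0 \<and> y = c"

abbreviation (input) nobad :: "'a \<Rightarrow> 'a \<Rightarrow> bool" where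
  "nobad \<equiv> \<lambda>_ _. False"

abbreviation (input) idrk :: "nat \<Rightarrow> nat" where
  "idrk \<equiv> \<lambda>x. x"

lemma saturated_atLeastAtMost:
  assumes "l \<le> h"
  shows "saturated idrk l h {l..h}"
proof -
  have "{l..h} = (\<lambda>x. l + x) ` {..h - l}"
    using image_add_atLeastAtMost[of l 0 "h - l"] assms by (simp add: atLeast0AtMost)
  then show ?thesis unfolding saturated_def using assms
    by (intro exI[of _ "\<lambda>x. l + x"] exI[of _ "h - l"]) auto
qed

lemma saturated_left:
  "saturated r p q C \<Longrightarrow> saturated (prodrk r s) (p, b) (q, b) (C \<times> {b})"
proof -
  assume "saturated r p q C"
  then have "saturated (prodrk r s) (p, b) (q, b) ((\<lambda>x. (x, b)) ` C)"
    by (rule saturated_image[where s = "s b"]) (auto simp: prodrk_def less_eq_prod_def)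
  moreover have "(\<lambda>x. (x, b)) ` C = C \<times> {b}" by auto
  ultimately show ?thesis by simp
qed

lemma saturated_right:
  "saturated s p q C \<Longrightarrow> saturated (prodrk r s) (a, p) (a, q) ({a} \<times> C)"
proof -
  assume "saturated s p q C"
  then have "saturated (prodrk r s) (a, p) (a, q) (Pair a ` C)"
    by (rule saturated_image[where s = "r a"]) (auto simp: prodrk_def less_eq_prod_def)
  moreover have "Pair a ` C = {a} \<times> C" by auto
  ultimately show ?thesis by simp
qed

lemma symchain_nat: "symchain idrk d {..d}"
  by (rule symchainI[OF saturated_atLeastAtMost[of 0 d]]) (auto simp: atLeast0AtMost)

lemma sdec_nat: "d \<le> 1 \<Longrightarrow> sdec idrk d (fullbad d) {..d}"
  by (rule sdec_single[OF symchain_nat]) (auto simp: fullbad_def)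

text \<open>The classical hooks: the bottom row followed by the last column is one chain, and what
  remains is a smaller grid shifted up by one.\<close>

lemma sdec_grid: "sdec (prodrk idrk idrk) (c + d) nobad ({..c} \<times> {..d})"
proof (induction c arbitrary: d)
  case 0
  have "symchain (prodrk idrk idrk) (0 + d) ({..0} \<times> {..d})"
    by (rule symchainI[OF saturated_right[OF saturated_atLeastAtMost[of 0 d]]])
       (auto simp: prodrk_def atLeast0AtMost)
  then show ?case by (intro sdec_single) auto
next
  case (Suc c)
  let ?r = "prodrk idrk idrk"
  show ?case
  proof (cases d)
    case 0
    have "symchain ?r (Suc c + d) ({..Suc c} \<times> {..d})"
      by (rule symchainI[OF saturated_left[OF saturated_atLeastAtMost[of 0 "Suc c"]]])
         (auto simp: prodrk_def atLeast0AtMost \<open>d = 0\<close>)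
    then show ?thesis by (intro sdec_single) auto
  next
    case d: (Suc e)
    have "saturated ?r (0, 0) (Suc c, d) ({0..Suc c} \<times> {0} \<union> {Suc c} \<times> {1..d})"
      by (rule saturated_append[OF saturated_left[OF saturated_atLeastAtMost]
            saturated_right[OF saturated_atLeastAtMost]])
         (auto simp: d prodrk_def)
    then have h: "symchain ?r (Suc c + d) ({0..Suc c} \<times> {0} \<union> {Suc c} \<times> {1..d})"
      by (rule symchainI) (auto simp: prodrk_def)
    have rest: "sdec ?r (Suc c + d) nobad ({..c} \<times> {1..d})"
      by (rule sdec_image[OF Suc.IH[of e], where \<phi> = "map_prod id Suc" and s = 1])
         (auto simp: d prodrk_def inj_on_def map_prod_surj_on[OF refl image_Suc_atMost])
    show ?thesis
      by (rule sdec_Un'[OF sdec_single[OF h] rest]) (auto simp: d)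
  qed
qed

text \<open>A bad pair of the product is bad in at least one coordinate, so the grid
  \<open>C \<times> D\<close> spanned by two chains contains none at all. How the grid is decomposed
  is then immaterial, and hooks suffice.\<close>

lemma sdec_prod:
  assumes P: "sdec r N B P" and Q: "sdec s M B' Q"
  shows "sdec (prodrk r s) (N + M) (prodbad B B') (P \<times> Q)"
proof -
  obtain \<C> where \<C>': "partition_on P \<C>"
    "\<forall>C\<in>\<C>. symchain r N C \<and> (\<forall>x\<in>C. \<forall>y\<in>C. \<not> B x y)"
    using P unfolding sdec_def by blast
  have \<C>: "partition_on P \<C>" "\<And>C. C \<in> \<C> \<Longrightarrow> symchain r N C"
    "\<And>C x y. C \<in> \<C> \<Longrightarrow> x \<in> C \<Longrightarrow> y \<in> C \<Longrightarrow> \<not> B x y"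
    using \<C>' by simp_all
  obtain \<D> where \<D>': "partition_on Q \<D>"
    "\<forall>D\<in>\<D>. symchain s M D \<and> (\<forall>x\<in>D. \<forall>y\<in>D. \<not> B' x y)"
    using Q unfolding sdec_def by blast
  have \<D>: "partition_on Q \<D>" "\<And>D. D \<in> \<D> \<Longrightarrow> symchain s M D"
    "\<And>D x y. D \<in> \<D> \<Longrightarrow> x \<in> D \<Longrightarrow> y \<in> D \<Longrightarrow> \<not> B' x y"
    using \<D>' by simp_all
  show ?thesis
  proof (rule sdec_partition)
    show "partition_on (P \<times> Q) ((\<lambda>(C, D). C \<times> D) ` (\<C> \<times> \<D>))"
    proof (rule partition_onI)
      show "\<Union> ((\<lambda>(C, D). C \<times> D) ` (\<C> \<times> \<D>)) = P \<times> Q"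
        using \<C>(1) \<D>(1) by (auto simp: partition_on_def)
      show "{} \<notin> (\<lambda>(C, D). C \<times> D) ` (\<C> \<times> \<D>)"
      proof
        assume "{} \<in> (\<lambda>(C, D). C \<times> D) ` (\<C> \<times> \<D>)"
        then obtain C D where "C \<in> \<C>" "D \<in> \<D>" "C \<times> D = {}" by auto
        moreover have "{} \<notin> \<C>" "{} \<notin> \<D>" using \<C>(1) \<D>(1) by (simp_all add: partition_on_def)
        ultimately show False by (auto simp: times_eq_iff)
      qed
      fix X Y assume "X \<in> (\<lambda>(C, D). C \<times> D) ` (\<C> \<times> \<D>)" "Y \<in> (\<lambda>(C, D). C \<times> D) ` (\<C> \<times> \<D>)" "X \<noteq> Y"
      then obtain C D C' D' where *: "X = C \<times> D" "Y = C' \<times> D'" and in1: "C \<in> \<C>" "C' \<in> \<C>"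
        and in2: "D \<in> \<D>" "D' \<in> \<D>" and "C \<noteq> C' \<or> D \<noteq> D'" by fast
      then have "C \<inter> C' = {} \<or> D \<inter> D' = {}"
        using partition_onD2[OF \<C>(1)] partition_onD2[OF \<D>(1)] disjointD by metis
      then show "disjnt X Y" unfolding * disjnt_def by auto
    qed
    fix X assume "X \<in> (\<lambda>(C, D). C \<times> D) ` (\<C> \<times> \<D>)"
    then obtain C D where CD: "X = C \<times> D" "C \<in> \<C>" "D \<in> \<D>" by auto
    obtain f n j where f: "C = f ` {..n}" "N = 2 * j + n" "\<forall>x\<le>n. r (f x) = j + x"
      "\<forall>x y. x \<le> y \<longrightarrow> y \<le> n \<longrightarrow> f x \<le> f y" "inj_on f {..n}"
      using symchain_param[OF \<C>(2)[OF CD(2)]] by blast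
    obtain g m i where g: "D = g ` {..m}" "M = 2 * i + m" "\<forall>x\<le>m. s (g x) = i + x"
      "\<forall>x y. x \<le> y \<longrightarrow> y \<le> m \<longrightarrow> g x \<le> g y" "inj_on g {..m}"
      using symchain_param[OF \<D>(2)[OF CD(3)]] by blast
    have nb: "\<not> prodbad B B' x y" if "x \<in> X" "y \<in> X" for x y
      using that \<C>(3)[OF CD(2)] \<D>(3)[OF CD(3)] unfolding CD(1) prodbad_def
      by (auto simp: prod_eq_iff)
    show "sdec (prodrk r s) (N + M) (prodbad B B') X"
    proof (rule sdec_image[OF sdec_grid[of n m], where \<phi> = "map_prod f g" and s = "i + j"])
      show "inj_on (map_prod f g) ({..n} \<times> {..m})" by (intro map_prod_inj_on f g)
      show X: "X = map_prod f g ` ({..n} \<times> {..m})"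
        unfolding CD(1) f(1) g(1) by (rule map_prod_surj_on[symmetric, OF refl refl])
      show "False" if "x \<in> {..n} \<times> {..m}" "y \<in> {..n} \<times> {..m}"
        "prodbad B B' (map_prod f g x) (map_prod f g y)" for x y
        using nb[of "map_prod f g x" "map_prod f g y"] that unfolding X by blast
    qed (use f g in \<open>auto simp: prodrk_def\<close>)
  qed
qed

section \<open>Chains as lists of segments, and the zigzags in a grid\<close>

lemma prodrk_Pair [simp]: "prodrk r s (a, b) = r a + s b"
  by (simp add: prodrk_def)

text \<open>Each segment is meant to vary in a single coordinate, so that the order interval is
  itself a chain. With symbolic bounds, a chain of unbounded length remains a list of fixed
  length.\<close>

definition segs :: "('a::order \<times> 'a) list \<Rightarrow> 'a set" where
  "segs L = (\<Union>(p, q)\<in>set L. {p..q})"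

lemma segs_simps [simp]: "segs [] = {}" "segs ((p, q) # L) = {p..q} \<union> segs L"
  by (auto simp: segs_def)

fun linked :: "('a::order \<Rightarrow> nat) \<Rightarrow> ('a \<times> 'a) list \<Rightarrow> bool" where
  "linked rk [] \<longleftrightarrow> False"
| "linked rk [(p, q)] \<longleftrightarrow> saturated rk p q {p..q}"
| "linked rk ((p, q) # (p', q') # L) \<longleftrightarrow>
     saturated rk p q {p..q} \<and> q \<le> p' \<and> rk p' = Suc (rk q) \<and> linked rk ((p', q') # L)"

lemma linked_saturated:
  "linked rk L \<Longrightarrow> saturated rk (fst (hd L)) (snd (last L)) (segs L)"
proof (induction rk L rule: linked.induct)
  case (3 rk p q p' q' L)
  then show ?case by (auto intro: saturated_append)
qed auto

lemma linked_symchain: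
  "linked rk L \<Longrightarrow> rk (fst (hd L)) + rk (snd (last L)) = N \<Longrightarrow> symchain rk N (segs L)"
  by (rule symchainI[OF linked_saturated]) auto

lemma saturated_Pair_left [simp]:
  assumes "saturated r p q {p..q}"
  shows "saturated (prodrk r s) (p, b) (q, b) {(p, b)..(q, b)}"
proof -
  have "{(p, b)..(q, b)} = {p..q} \<times> {b}" by (auto simp: less_eq_prod_def)
  then show ?thesis using saturated_left[OF assms] by simp
qed

lemma saturated_Pair_right [simp]:
  assumes "saturated s p q {p..q}"
  shows "saturated (prodrk r s) (a, p) (a, q) {(a, p)..(a, q)}"
proof -
  have "{(a, p)..(a, q)} = {a} \<times> {p..q}" by (auto simp: less_eq_prod_def)
  then show ?thesis using saturated_right[OF assms] by simp
qed

declare saturated_atLeastAtMost [simp]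

declare saturated_single [simp]

text \<open>The zigzag leaves row \<open>1\<close> before reaching column \<open>c\<close> and
  enters column \<open>c - 1\<close> above row \<open>0\<close>; thus it contains no complete row
  and no complete column.\<close>

definition zig0 :: "nat \<Rightarrow> nat \<Rightarrow> (nat \<times> nat) set" where
  "zig0 c d = segs [((0, 0), (0, 1)), ((1, 1), (c - 1, 1)), ((c - 1, 2), (c - 1, d)), ((c, d), (c, d))]"

definition zig1 :: "nat \<Rightarrow> nat \<Rightarrow> (nat \<times> nat) set" where
  "zig1 c d = segs [((1, 0), (c, 0)), ((c, 1), (c, d - 1))]"

text \<open>A bad pair starts in row \<open>0\<close> or ends in column \<open>c\<close>, and the
  rectangle left over by the two chains avoids both. \<open>zig1\<close> misses the corners
  \<open>(0, 0)\<close> and \<open>(c, d)\<close>, which are the missing ends of its row and its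
  column.\<close>

lemma zigzag:
  assumes "2 \<le> c" "2 \<le> d"
  shows "saturated (prodrk idrk idrk) (0, 0) (c, d) (zig0 c d)"
    and "saturated (prodrk idrk idrk) (1, 0) (c, d - 1) (zig1 c d)"
    and "{..c} \<times> {..d} = zig0 c d \<union> (zig1 c d \<union> {..c - 2} \<times> {2..d})"
    and "zig0 c d \<inter> (zig1 c d \<union> {..c - 2} \<times> {2..d}) = {}"
    and "zig1 c d \<inter> ({..c - 2} \<times> {2..d}) = {}"
    and "\<forall>x\<in>zig0 c d. \<forall>y\<in>zig0 c d.
      prodbad (fullbad c) (fullbad d) x y \<longrightarrow> x = (0, 0) \<and> y = (c, d)"
    and "\<forall>x\<in>zig1 c d. \<forall>y\<in>zig1 c d. \<not> prodbad (fullbad c) (fullbad d) x y"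
proof -
  obtain c' d' where cd: "c = c' + 2" "d = d' + 2"
    using assms by (metis le_add_diff_inverse2)
  show "saturated (prodrk idrk idrk) (0, 0) (c, d) (zig0 c d)"
    using linked_saturated[of "prodrk idrk idrk" "[((0, 0), (0, 1)), ((1, 1), (c - 1, 1)), ((c - 1, 2), (c - 1, d)), ((c, d), (c, d))]"]
    unfolding zig0_def cd by simp
  show "saturated (prodrk idrk idrk) (1, 0) (c, d - 1) (zig1 c d)"
    using linked_saturated[of "prodrk idrk idrk" "[((1, 0), (c, 0)), ((c, 1), (c, d - 1))]"]
    unfolding zig1_def cd by simp
  show "{..c} \<times> {..d} = zig0 c d \<union> (zig1 c d \<union> {..c - 2} \<times> {2..d})"
    unfolding zig0_def zig1_def cd by (auto simp: less_eq_prod_def)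
  show "zig0 c d \<inter> (zig1 c d \<union> {..c - 2} \<times> {2..d}) = {}"
    unfolding zig0_def zig1_def cd by (auto simp: less_eq_prod_def)
  show "zig1 c d \<inter> ({..c - 2} \<times> {2..d}) = {}"
    unfolding zig1_def cd by (auto simp: less_eq_prod_def)
  show "\<forall>x\<in>zig0 c d. \<forall>y\<in>zig0 c d.
      prodbad (fullbad c) (fullbad d) x y \<longrightarrow> x = (0, 0) \<and> y = (c, d)"
    unfolding zig0_def cd by (auto simp: less_eq_prod_def prodbad_def fullbad_def)
  show "\<forall>x\<in>zig1 c d. \<forall>y\<in>zig1 c d. \<not> prodbad (fullbad c) (fullbad d) x y"
    unfolding zig1_def cd by (auto simp: less_eq_prod_def prodbad_def fullbad_def)
qed

lemma image_shift:
  fixes k b :: nat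
  assumes "k \<le> b"
  shows "(\<lambda>u. (fst u, snd u + k)) ` (X \<times> {..b - k}) = X \<times> {k..b}"
proof (intro equalityI subsetI)
  fix x assume x: "x \<in> X \<times> {k..b}"
  then show "x \<in> (\<lambda>u. (fst u, snd u + k)) ` (X \<times> {..b - k})"
    by (intro image_eqI[of _ _ "(fst x, snd x - k)"]) auto
qed (use assms in auto)

lemma sdec_rect:
  assumes "2 \<le> c" "2 \<le> d"
    and "\<And>x y. x \<in> {..c - 2} \<times> {2..d} \<Longrightarrow> y \<in> {..c - 2} \<times> {2..d} \<Longrightarrow> \<not> B x y"
  shows "sdec (prodrk idrk idrk) (c + d) B ({..c - 2} \<times> {2..d})"
proof (rule sdec_image[OF sdec_grid[of "c - 2" "d - 2"], where \<phi> = "\<lambda>u. (fst u, snd u + 2)" and s = 2])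
  show im: "{..c - 2} \<times> {2..d} = (\<lambda>u. (fst u, snd u + 2)) ` ({..c - 2} \<times> {..d - 2})"
    by (rule image_shift[OF assms(2), symmetric])
  show "False" if "x \<in> {..c - 2} \<times> {..d - 2}" "y \<in> {..c - 2} \<times> {..d - 2}"
    "B (fst x, snd x + 2) (fst y, snd y + 2)" for x y
    using assms(3) that(3) imageI[OF that(1), of "\<lambda>u. (fst u, snd u + 2)"]
      imageI[OF that(2), of "\<lambda>u. (fst u, snd u + 2)"] unfolding im[symmetric] by blast
qed (use assms(1,2) in \<open>auto simp: inj_on_def less_eq_prod_def prodrk_def prod_eq_iff\<close>)

section \<open>Absorbing sets\<close>

text \<open>The factor \<open>{..c}\<close> stands for the longest chain of a zigzag, whose only bad
  pair is its two endpoints. All \<open>c\<close> are required because a further factor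
  \<open>{..a}\<close> turns \<open>c\<close> into \<open>c + a\<close>.\<close>

definition absorbing :: "('a::order \<Rightarrow> nat) \<Rightarrow> nat \<Rightarrow> ('a \<Rightarrow> 'a \<Rightarrow> bool) \<Rightarrow> 'a set \<Rightarrow> bool" where
  "absorbing rk N B P \<longleftrightarrow>
     (\<forall>c. sdec (prodrk idrk rk) (c + N) (prodbad (fullbad c) B) ({..c} \<times> P))"

lemma absorbing_imp_sdec:
  assumes "absorbing rk N B P" shows "sdec rk N B P"
proof (rule sdec_image[where \<phi> = snd and s = 0])
  show "sdec (prodrk idrk rk) (0 + N) (prodbad (fullbad 0) B) ({..0} \<times> P)"
    using assms unfolding absorbing_def by blast
qed (auto simp: inj_on_def prodrk_def prodbad_def less_eq_prod_def image_iff)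

text \<open>For \<open>c \<le> 1\<close> the relation \<open>fullbad c\<close> is empty, so
  multiplying decompositions is enough.\<close>

lemma absorbingI:
  assumes "sdec rk N B P"
    and "\<And>c. 2 \<le> c \<Longrightarrow> sdec (prodrk idrk rk) (c + N) (prodbad (fullbad c) B) ({..c} \<times> P)"
  shows "absorbing rk N B P"
  unfolding absorbing_def
proof
  fix c :: nat
  show "sdec (prodrk idrk rk) (c + N) (prodbad (fullbad c) B) ({..c} \<times> P)"
  proof (cases "2 \<le> c")
    case False
    then show ?thesis by (intro sdec_prod sdec_nat assms(1)) simp
  qed (rule assms(2))
qed

lemma absorbing_image:
  assumes "absorbing rk N B P" "inj_on \<phi> P"
    and "\<And>x y. x \<in> P \<Longrightarrow> y \<in> P \<Longrightarrow> x \<le> y \<Longrightarrow> \<phi> x \<le> \<phi> y"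
    and "\<And>x. x \<in> P \<Longrightarrow> rk' (\<phi> x) = rk x + s"
    and "N' = N + 2 * s"
    and "\<And>x y. x \<in> P \<Longrightarrow> y \<in> P \<Longrightarrow> B' (\<phi> x) (\<phi> y) \<Longrightarrow> B x y"
    and "P' = \<phi> ` P"
  shows "absorbing rk' N' B' P'"
  unfolding absorbing_def
proof
  fix c :: nat
  have inj: "\<phi> x = \<phi> y \<longleftrightarrow> x = y" if "x \<in> P" "y \<in> P" for x y
    using assms(2) that by (auto simp: inj_on_def)
  show "sdec (prodrk idrk rk') (c + N') (prodbad (fullbad c) B') ({..c} \<times> P')"
  proof (rule sdec_image[where \<phi> = "map_prod id \<phi>" and s = s])
    show "sdec (prodrk idrk rk) (c + N) (prodbad (fullbad c) B) ({..c} \<times> P)"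
      using assms(1) unfolding absorbing_def by blast
    show "inj_on (map_prod id \<phi>) ({..c} \<times> P)" by (rule map_prod_inj_on[OF inj_on_id assms(2)])
    show "{..c} \<times> P' = map_prod id \<phi> ` ({..c} \<times> P)"
      unfolding assms(7) by (subst map_prod_surj_on[where f = id and A = "{..c}"]) auto
    show "prodbad (fullbad c) B x y"
      if "x \<in> {..c} \<times> P" "y \<in> {..c} \<times> P" "prodbad (fullbad c) B' (map_prod id \<phi> x) (map_prod id \<phi> y)"
      for x y
      using that assms(6)[of "snd x" "snd y"] inj[of "snd x" "snd y"]
      by (auto simp: prodbad_def)
  qed (use assms(3,4,5) in \<open>auto simp: prodrk_def less_eq_prod_def\<close>)
qed

lemma absorbing_Un:
  assumes "absorbing rk N B P" "absorbing rk N B Q" "P \<inter> Q = {}" "S = P \<union> Q"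
  shows "absorbing rk N B S"
  unfolding absorbing_def
proof
  fix c :: nat
  show "sdec (prodrk idrk rk) (c + N) (prodbad (fullbad c) B) ({..c} \<times> S)"
  proof (rule sdec_Un')
    show "{..c} \<times> S = {..c} \<times> P \<union> {..c} \<times> Q" using assms(4) by blast
    show "({..c} \<times> P) \<inter> ({..c} \<times> Q) = {}" using assms(3) by blast
  qed (use assms(1,2) in \<open>auto simp: absorbing_def\<close>)
qed

lemma absorbing_empty: "absorbing rk N B {}"
  by (simp add: absorbing_def sdec_empty)

text \<open>When the second factor has no bad pairs, the corners \<open>(0, 0)\<close> and
  \<open>(c, d)\<close> are not a bad pair either, since they differ in the second coordinate. The
  zigzags are then free of bad pairs.\<close>

lemma absorbing_nat:
  assumes "2 \<le> d" shows "absorbing idrk d nobad {..d}"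
proof (rule absorbingI)
  show "sdec idrk d nobad {..d}" by (rule sdec_single[OF symchain_nat]) auto
  fix c :: nat assume c: "2 \<le> c"
  let ?B = "prodbad (fullbad c) (nobad :: nat \<Rightarrow> nat \<Rightarrow> bool)"
  note z = zigzag[OF c assms]
  have sub: "prodbad (fullbad c) (fullbad d) x y \<and> fst x \<noteq> fst y \<and> snd x = snd y" if "?B x y" for x y
    using that c by (auto simp: prodbad_def fullbad_def)
  have z0: "sdec (prodrk idrk idrk) (c + d) ?B (zig0 c d)"
    by (rule sdec_single[OF symchainI[OF z(1)]]) (use z(6) sub c assms in fastforce)+
  have z1: "sdec (prodrk idrk idrk) (c + d) ?B (zig1 c d)"
    by (rule sdec_single[OF symchainI[OF z(2)]]) (use z(7) sub c assms in fastforce)+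
  have r: "sdec (prodrk idrk idrk) (c + d) ?B ({..c - 2} \<times> {2..d})"
    using c assms by (intro sdec_rect) (auto simp: prodbad_def fullbad_def)
  show "sdec (prodrk idrk idrk) (c + d) ?B ({..c} \<times> {..d})"
    by (rule sdec_Un'[OF z0 sdec_Un'[OF z1 r z(5) refl] z(4) z(3)])
qed

lemma absorbing_chain:
  assumes "saturated rk p q C" "rk p + 2 \<le> rk q" "N = rk p + rk q" "\<forall>x\<in>C. \<forall>y\<in>C. \<not> B x y"
  shows "absorbing rk N B C"
proof -
  obtain f n where f: "C = f ` {..n}" "f 0 = p" "f n = q" "\<forall>x\<le>n. rk (f x) = rk p + x"
     "\<forall>x y. x \<le> y \<longrightarrow> y \<le> n \<longrightarrow> f x \<le> f y" using assms(1) unfolding saturated_def by blast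
  have n: "rk q = rk p + n" using f(3,4) by auto
  show ?thesis
  proof (rule absorbing_image[OF absorbing_nat[of n], where \<phi> = f and s = "rk p"])
    show "inj_on f {..n}" using f(4) by (intro inj_onI) (metis add_left_cancel atMost_iff)
    show "2 \<le> n" "N = n + 2 * rk p" using n assms(2,3) by auto
    show "B (f x) (f y) \<Longrightarrow> False" if "x \<in> {..n}" "y \<in> {..n}" for x y
      using assms(4) that unfolding f(1) by blast
    show "f x \<le> f y" if "x \<in> {..n}" "y \<in> {..n}" "x \<le> y" for x y
      using f(5) that by simp
    show "rk (f x) = x + rk p" if "x \<in> {..n}" for x using f(4) that by simp
  qed (fact f(1))
qed

lemma prodbad_assoc:
  "prodbad A (prodbad B C) (x, p, y) (x', p', y') \<longleftrightarrow> prodbad (prodbad A B) C ((x, p), y) ((x', p'), y')"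
  by (simp add: prodbad_def) blast

lemma prodbad_rotate:
  "prodbad A (prodbad B C) (x, p, y) (x', p', y') \<longleftrightarrow> prodbad (prodbad A C) B ((x, y), p) ((x', y'), p')"
  by (simp add: prodbad_def) blast

lemma prodbad_swap: "prodbad B C (p, y) (p', y') \<longleftrightarrow> prodbad C B (y, p) (y', p')"
  by (simp add: prodbad_def) blast

lemma sdec_assoc:
  assumes "sdec (prodrk (prodrk r s) t) N (prodbad (prodbad A B) C) ((X \<times> Y) \<times> Z)"
  shows "sdec (prodrk r (prodrk s t)) N (prodbad A (prodbad B C)) (X \<times> Y \<times> Z)"
proof (rule sdec_image[OF assms, where \<phi> = "\<lambda>u. (fst (fst u), snd (fst u), snd u)" and s = 0])
  show "X \<times> Y \<times> Z = (\<lambda>u. (fst (fst u), snd (fst u), snd u)) ` ((X \<times> Y) \<times> Z)" by force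
  show "prodbad (prodbad A B) C u v"
    if "prodbad A (prodbad B C) (fst (fst u), snd (fst u), snd u) (fst (fst v), snd (fst v), snd v)" for u v
    using that by (simp add: prodbad_assoc)
qed (auto simp: inj_on_def less_eq_prod_def)

text \<open>As far as bad pairs matter, \<open>D\<close> is \<open>{..n}\<close> with
  \<open>n = r v - r u\<close>, so the absorption property of \<open>P\<close> applies with
  \<open>c = n\<close>. This removes the bad pair that a zigzag cannot avoid.\<close>

lemma chain_times_absorbing:
  assumes "saturated r u v D" "\<forall>x\<in>D. \<forall>y\<in>D. A x y \<longrightarrow> x = u \<and> y = v" "r u + 2 \<le> r v"
    and "absorbing rk N B P"
  shows "sdec (prodrk r rk) (r u + r v + N) (prodbad A B) (D \<times> P)"
proof -
  obtain f n where f: "D = f ` {..n}" "f 0 = u" "f n = v" "\<forall>x\<le>n. r (f x) = r u + x"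
     "\<forall>x y. x \<le> y \<longrightarrow> y \<le> n \<longrightarrow> f x \<le> f y" using assms(1) unfolding saturated_def by blast
  have n: "r v = r u + n" using f(3,4) by blast
  have inj: "x = y" if "f x = f y" "x \<le> n" "y \<le> n" for x y
    using f(4) that by (metis add_left_cancel)
  have s: "sdec (prodrk idrk rk) (n + N) (prodbad (fullbad n) B) ({..n} \<times> P)"
    using assms(4) unfolding absorbing_def by blast
  show ?thesis
  proof (rule sdec_image[OF s, where \<phi> = "map_prod f id" and s = "r u"])
    show "inj_on (map_prod f id) ({..n} \<times> P)"
      by (rule map_prod_inj_on[OF _ inj_on_id]) (use inj in \<open>auto intro: inj_onI\<close>)
    show "D \<times> P = map_prod f id ` ({..n} \<times> P)"
      unfolding f(1) by (subst map_prod_surj_on[where g = id and B = P]) auto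
    fix x y :: "nat \<times> 'b" assume xy: "x \<in> {..n} \<times> P" "y \<in> {..n} \<times> P"
    then have le: "fst x \<le> n" "fst y \<le> n" by auto
    have eq: "fst x = fst y" if "f (fst x) = f (fst y)" using inj that le by blast
    have full: "fullbad n (fst x) (fst y)" if "A (f (fst x)) (f (fst y))"
    proof -
      have "f (fst x) = f 0" "f (fst y) = f n"
        using assms(2) that le f(2,3) unfolding f(1) by auto
      then have "fst x = 0" "fst y = n" using inj le by blast+
      then show ?thesis using n assms(3) by (simp add: fullbad_def)
    qed
    show "prodbad (fullbad n) B x y" if "prodbad A B (map_prod f id x) (map_prod f id y)"
      using that eq full unfolding prodbad_def by auto
    show "map_prod f id x \<le> map_prod f id y" if "x \<le> y"
      using that f(5) le by (simp add: less_eq_prod_def)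
  next
    fix x :: "nat \<times> 'b" assume "x \<in> {..n} \<times> P"
    then show "prodrk r rk (map_prod f id x) = prodrk idrk rk x + r u"
      using f(4) by (auto simp: prodrk_def)
  qed (use n in simp)
qed

text \<open>The zigzags combine the first and the last factor of
  \<open>{..c} \<times> P \<times> {..a}\<close>; this map restores the order of the
  factors.\<close>

definition rotate3 :: "('a \<times> 'b) \<times> 'c \<Rightarrow> 'a \<times> 'c \<times> 'b" where
  "rotate3 u = (fst (fst u), snd u, snd (fst u))"

lemma sdec_rotate:
  assumes "sdec (prodrk (prodrk r t) s) N (prodbad (prodbad A C) B) W"
  shows "sdec (prodrk r (prodrk s t)) N (prodbad A (prodbad B C)) (rotate3 ` W)"
proof (rule sdec_image[OF assms, where \<phi> = rotate3 and s = 0])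
  show "prodbad (prodbad A C) B u v"
    if "prodbad A (prodbad B C) (rotate3 u) (rotate3 v)" for u v
    using that by (simp add: prodbad_rotate rotate3_def)
qed (auto simp: inj_on_def less_eq_prod_def rotate3_def prod_eq_iff)

lemma sdec_swap:
  assumes "sdec (prodrk r s) N (prodbad A B) (X \<times> Y)"
  shows "sdec (prodrk s r) N (prodbad B A) (Y \<times> X)"
proof (rule sdec_image[OF assms, where \<phi> = prod.swap and s = 0])
  show "prodbad A B u v" if "prodbad B A (prod.swap u) (prod.swap v)" for u v
    using that prodbad_swap[of B A "snd u" "fst u" "snd v" "fst v"] by (simp add: prod.swap_def)
qed (auto simp: less_eq_prod_def)

text \<open>If \<open>a \<le> 1\<close>, the new factor has no bad pairs and is simply multiplied
  on. Otherwise \<open>{..c} \<times> {..a}\<close> is cut into zigzags: the longest one is absorbed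
  by \<open>P\<close>, and the other pieces have no bad pairs, so any decomposition of
  \<open>P\<close> can be multiplied with them.\<close>

lemma absorbing_prod:
  assumes "absorbing rk N B P"
  shows "absorbing (prodrk rk idrk) (N + a) (prodbad B (fullbad a)) (P \<times> {..a})"
proof (cases "2 \<le> a")
  case False
  show ?thesis unfolding absorbing_def
  proof
    fix c :: nat
    have s: "sdec (prodrk idrk rk) (c + N) (prodbad (fullbad c) B) ({..c} \<times> P)"
      using assms unfolding absorbing_def by blast
    have a: "sdec idrk a (fullbad a) {..a}" using False by (intro sdec_nat) simp
    show "sdec (prodrk idrk (prodrk rk idrk)) (c + (N + a))
      (prodbad (fullbad c) (prodbad B (fullbad a))) ({..c} \<times> P \<times> {..a})"
      using sdec_assoc[OF sdec_prod[OF s a]] by (simp add: add.assoc)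
  qed
next
  case a: True
  let ?B = "\<lambda>c. prodbad (fullbad c) (prodbad B (fullbad a))"
  let ?r = "prodrk idrk (prodrk rk idrk)"
  have P: "sdec rk N B P" by (rule absorbing_imp_sdec[OF assms])
  show ?thesis
  proof (rule absorbingI)
    have s: "sdec (prodrk idrk rk) (a + N) (prodbad (fullbad a) B) ({..a} \<times> P)"
      using assms unfolding absorbing_def by blast
    show "sdec (prodrk rk idrk) (N + a) (prodbad B (fullbad a)) (P \<times> {..a})"
      using sdec_swap[OF s] by (simp add: add.commute)
  next
    fix c :: nat assume c: "2 \<le> c"
    note z = zigzag[OF c a]
    let ?T = "\<lambda>Z :: (nat \<times> nat) set. rotate3 ` (Z \<times> P)"
    have nb: "sdec ?r (c + (N + a)) (?B c) (?T Z)"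
      if "sdec (prodrk idrk idrk) (c + a) (prodbad (fullbad c) (fullbad a)) Z" for Z
      using sdec_rotate[OF sdec_prod[OF that P]] by (simp add: ac_simps)
    have "sdec (prodrk (prodrk idrk idrk) rk) (c + a + N) (prodbad (prodbad (fullbad c) (fullbad a)) B)
      (zig0 c a \<times> P)"
      using chain_times_absorbing[OF z(1,6) _ assms] c by simp
    then have z0: "sdec ?r (c + (N + a)) (?B c) (?T (zig0 c a))"
      using sdec_rotate by (simp add: ac_simps)
    have z1: "sdec ?r (c + (N + a)) (?B c) (?T (zig1 c a))"
      by (rule nb[OF sdec_single[OF symchainI[OF z(2)]]]) (use z(7) c a in auto)
    have "sdec (prodrk idrk idrk) (c + a) (prodbad (fullbad c) (fullbad a)) ({..c - 2} \<times> {2..a})"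
      using c a by (intro sdec_rect) (auto simp: prodbad_def fullbad_def)
    then have r: "sdec ?r (c + (N + a)) (?B c) (?T ({..c - 2} \<times> {2..a}))" by (rule nb)
    have T_int: "?T Y \<inter> ?T Z = {}" if "Y \<inter> Z = {}" for Y Z
      using that by (auto simp: rotate3_def)
    have T_un: "?T (Y \<union> Z) = ?T Y \<union> ?T Z" for Y Z by auto
    have T_all: "{..c} \<times> P \<times> {..a} = ?T ({..c} \<times> {..a})" by (force simp: rotate3_def)
    show "sdec ?r (c + (N + a)) (?B c) ({..c} \<times> P \<times> {..a})"
      unfolding T_all z(3) T_un
      by (intro sdec_Un z0 z1 r T_int z(5)) (use T_int[OF z(4)] in \<open>simp add: T_un\<close>)
  qed
qed

text \<open>One side of the rectangle has at least three points. Without bad pairs on it this side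
  is absorbing, and the other side is multiplied on. The rectangle itself contains no bad pair, so
  nothing is lost in the transfer.\<close>

lemma zigzag_rect:
  assumes "2 \<le> c" "2 \<le> d" "4 \<le> c \<or> 4 \<le> d"
  shows "absorbing (prodrk idrk idrk) (c + d) (prodbad (fullbad c) (fullbad d)) ({..c - 2} \<times> {2..d})"
proof -
  have shift: "{2..d} = (\<lambda>y. y + 2) ` {..d - 2}"
    using image_add_atLeastAtMost[of 2 0 "d - 2"] assms by (simp add: atLeast0AtMost add.commute)
  from assms(3) show ?thesis
  proof
    assume "4 \<le> c"
    then have "absorbing idrk (c - 2) nobad {..c - 2}" by (intro absorbing_nat) simp
    from absorbing_prod[OF this, of "d - 2"] show ?thesis
    proof (rule absorbing_image[where \<phi> = "map_prod id (\<lambda>y. y + 2)" and s = 2])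
      show "{..c - 2} \<times> {2..d} = map_prod id (\<lambda>y. y + 2) ` ({..c - 2} \<times> {..d - 2})"
        unfolding shift by (subst map_prod_surj_on[where f = id and A = "{..c - 2}"]) auto
    qed (use assms in \<open>auto simp: prodbad_def fullbad_def inj_on_def\<close>)
  next
    assume "4 \<le> d"
    then have "absorbing idrk (d - 2) nobad {..d - 2}" by (intro absorbing_nat) simp
    from absorbing_prod[OF this, of "c - 2"] show ?thesis
    proof (rule absorbing_image[where \<phi> = "\<lambda>u. (snd u, fst u + 2)" and s = 2])
      show "{..c - 2} \<times> {2..d} = (\<lambda>u. (snd u, fst u + 2)) ` ({..d - 2} \<times> {..c - 2})"
        unfolding shift by force
    qed (use assms in \<open>auto simp: prodbad_def fullbad_def inj_on_def less_eq_prod_def\<close>)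
  qed
qed

section \<open>Sets that absorb up to one long chain\<close>

text \<open>The gap of \<open>4\<close> makes \<open>D\<close> a copy of \<open>{..n}\<close> with
  \<open>n \<ge> 4\<close>. In a product with \<open>{..a}\<close>, \<open>a \<ge> 2\<close>, the
  rectangle \<open>{..n - 2} \<times> {2..a}\<close> then has a side with three points, so it is
  absorbing. The bound also covers the explicit boxes that need \<open>n \<ge> 3\<close>.\<close>

definition near_absorbing ::
    "('a::order \<Rightarrow> nat) \<Rightarrow> nat \<Rightarrow> ('a \<Rightarrow> 'a \<Rightarrow> bool) \<Rightarrow> 'a \<Rightarrow> 'a \<Rightarrow> 'a set \<Rightarrow> bool" where
  "near_absorbing rk N B u v P \<longleftrightarrow> (\<exists>D R. P = D \<union> R \<and> D \<inter> R = {} \<and> saturated rk u v D \<and>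
     N = rk u + rk v \<and> rk u + 4 \<le> rk v \<and> (\<forall>x\<in>D. \<forall>y\<in>D. B x y \<longrightarrow> x = u \<and> y = v) \<and> absorbing rk N B R)"

text \<open>The long chain is \<open>zig0\<close>. Both \<open>zig1\<close>, a chain without bad
  pairs, and the remaining rectangle are absorbing.\<close>

lemma near_absorbing_grid:
  assumes "4 \<le> c" "2 \<le> d"
  shows "near_absorbing (prodrk idrk idrk) (c + d) (prodbad (fullbad c) (fullbad d)) (0, 0) (c, d) ({..c} \<times> {..d})"
proof -
  have c: "2 \<le> c" using assms by simp
  note z = zigzag[OF c assms(2)]
  have a1: "absorbing (prodrk idrk idrk) (c + d) (prodbad (fullbad c) (fullbad d)) (zig1 c d)"
    by (rule absorbing_chain[OF z(2) _ _ z(7)]) (use assms in auto)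
  have a2: "absorbing (prodrk idrk idrk) (c + d) (prodbad (fullbad c) (fullbad d)) ({..c - 2} \<times> {2..d})"
    using assms by (intro zigzag_rect) auto
  show ?thesis unfolding near_absorbing_def
    by (rule exI[of _ "zig0 c d"], rule exI[of _ "zig1 c d \<union> {..c - 2} \<times> {2..d}"], intro conjI z(1,3,4,6)
        absorbing_Un[OF a1 a2 z(5) refl]) (use assms in auto)
qed

lemma near_absorbing_image:
  assumes "near_absorbing rk N B u v P" "inj_on \<phi> P"
    and "\<And>x y. x \<in> P \<Longrightarrow> y \<in> P \<Longrightarrow> x \<le> y \<Longrightarrow> \<phi> x \<le> \<phi> y"
    and "\<And>x. x \<in> P \<Longrightarrow> rk' (\<phi> x) = rk x + s"
    and "N' = N + 2 * s"
    and "\<And>x y. x \<in> P \<Longrightarrow> y \<in> P \<Longrightarrow> B' (\<phi> x) (\<phi> y) \<Longrightarrow> B x y"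
    and "P' = \<phi> ` P" "u' = \<phi> u" "v' = \<phi> v"
  shows "near_absorbing rk' N' B' u' v' P'"
proof -
  obtain D R where *: "P = D \<union> R" "D \<inter> R = {}" "saturated rk u v D" "N = rk u + rk v"
    "rk u + 4 \<le> rk v" "\<forall>x\<in>D. \<forall>y\<in>D. B x y \<longrightarrow> x = u \<and> y = v" "absorbing rk N B R"
    using assms(1) unfolding near_absorbing_def by blast
  have uv: "u \<in> P" "v \<in> P" using saturated_le(3,4)[OF *(3)] *(1) by auto
  have sub: "D \<subseteq> P" "R \<subseteq> P" using *(1) by auto
  show ?thesis unfolding near_absorbing_def
  proof (rule exI[of _ "\<phi> ` D"], rule exI[of _ "\<phi> ` R"], intro conjI)
    show "P' = \<phi> ` D \<union> \<phi> ` R" unfolding assms(7) *(1) by (rule image_Un)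
    show "\<phi> ` D \<inter> \<phi> ` R = {}"
      using inj_on_image_Int[OF assms(2) sub] *(2) by simp
    show "saturated rk' u' v' (\<phi> ` D)" unfolding assms(8,9)
    proof (rule saturated_image[OF *(3)])
      show "\<phi> x \<le> \<phi> y" if "x \<in> D" "y \<in> D" "x \<le> y" for x y
        by (rule assms(3)) (use that sub in auto)
      show "rk' (\<phi> x) = rk x + s" if "x \<in> D" for x
        by (rule assms(4)) (use that sub in auto)
    qed
    show "N' = rk' u' + rk' v'" "rk' u' + 4 \<le> rk' v'"
      using assms(4)[OF uv(1)] assms(4)[OF uv(2)] assms(5,8,9) *(4,5) by simp_all
    show "\<forall>x\<in>\<phi> ` D. \<forall>y\<in>\<phi> ` D. B' x y \<longrightarrow> x = u' \<and> y = v'"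
    proof (intro ballI impI)
      fix x y assume "x \<in> \<phi> ` D" "y \<in> \<phi> ` D" and b: "B' x y"
      then obtain x0 y0 where x0: "x0 \<in> D" "y0 \<in> D" "x = \<phi> x0" "y = \<phi> y0" by blast
      have "B x0 y0" by (rule assms(6)) (use b x0 sub in auto)
      then show "x = u' \<and> y = v'" using *(6) x0 assms(8,9) by blast
    qed
    show "absorbing rk' N' B' (\<phi> ` R)"
    proof (rule absorbing_image[OF *(7) inj_on_subset[OF assms(2) sub(2)]])
      show "\<phi> x \<le> \<phi> y" if "x \<in> R" "y \<in> R" "x \<le> y" for x y
        by (rule assms(3)) (use that sub in auto)
      show "rk' (\<phi> x) = rk x + s" if "x \<in> R" for x
        by (rule assms(4)) (use that sub in auto)
      show "B x y" if "x \<in> R" "y \<in> R" "B' (\<phi> x) (\<phi> y)" for x y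
        by (rule assms(6)) (use that sub in auto)
    qed (use assms(5) in simp_all)
  qed
qed

lemma near_absorbing_Un:
  assumes "near_absorbing rk N B u v P" "absorbing rk N B Q" "P \<inter> Q = {}" "S = P \<union> Q"
  shows "near_absorbing rk N B u v S"
proof -
  obtain D R where *: "P = D \<union> R" "D \<inter> R = {}" "saturated rk u v D" "N = rk u + rk v"
    "rk u + 4 \<le> rk v" "\<forall>x\<in>D. \<forall>y\<in>D. B x y \<longrightarrow> x = u \<and> y = v" "absorbing rk N B R"
    using assms(1) unfolding near_absorbing_def by blast
  show ?thesis unfolding near_absorbing_def
    by (rule exI[of _ D], rule exI[of _ "R \<union> Q"], intro conjI *(3-6) absorbing_Un[OF *(7) assms(2)])
       (use * assms(3,4) in auto)
qed

text \<open>\<open>D \<times> {..a}\<close> behaves like the grid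
  \<open>{..n} \<times> {..a}\<close>, which contributes the new long chain, and
  \<open>R \<times> {..a}\<close> is absorbing. For \<open>a = 1\<close> the grid has only two rows
  and the zigzags do not exist.\<close>

lemma near_absorbing_prod:
  assumes "near_absorbing rk N B u v P" "a \<noteq> 1"
  shows "near_absorbing (prodrk rk idrk) (N + a) (prodbad B (fullbad a)) (u, 0) (v, a) (P \<times> {..a})"
proof -
  obtain D R where *: "P = D \<union> R" "D \<inter> R = {}" "saturated rk u v D" "N = rk u + rk v"
    "rk u + 4 \<le> rk v" "\<forall>x\<in>D. \<forall>y\<in>D. B x y \<longrightarrow> x = u \<and> y = v" "absorbing rk N B R"
    using assms(1) unfolding near_absorbing_def by blast
  obtain f n where f: "D = f ` {..n}" "f 0 = u" "f n = v" "\<forall>x\<le>n. rk (f x) = rk u + x"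
     "\<forall>x y. x \<le> y \<longrightarrow> y \<le> n \<longrightarrow> f x \<le> f y" using *(3) unfolding saturated_def by blast
  have n: "rk v = rk u + n" using f(3,4) by blast
  have inj: "x = y" if "f x = f y" "x \<le> n" "y \<le> n" for x y
    using f(4) that by (metis add_left_cancel)
  have full: "x = 0 \<and> y = n" if "B (f x) (f y)" "x \<le> n" "y \<le> n" for x y
  proof -
    have "f x = f 0" "f y = f n" using *(6) that f(2,3) unfolding f(1) by auto
    then show ?thesis using inj[of x 0] inj[of y n] that by auto
  qed
  have grid: "near_absorbing (prodrk idrk idrk) (n + a) (prodbad (fullbad n) (fullbad a)) (0, 0) (n, a) ({..n} \<times> {..a})"
  proof (cases "a = 0")
    case True
    have "saturated (prodrk idrk idrk) (0, 0) (n, 0) ({0..n} \<times> {0})"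
      by (rule saturated_left[OF saturated_atLeastAtMost]) simp
    then have "saturated (prodrk idrk idrk) (0, 0) (n, a) ({..n} \<times> {..a})"
      using True by (simp add: atLeast0AtMost)
    then show ?thesis unfolding near_absorbing_def
      using True n *(5)
      by - (rule exI[of _ "{..n} \<times> {..a}"], rule exI[of _ "{}"],
         auto simp: absorbing_empty prodbad_def fullbad_def)
  next
    case False
    then show ?thesis using near_absorbing_grid[of n a] n *(5) assms(2) by simp
  qed
  have D: "near_absorbing (prodrk rk idrk) (N + a) (prodbad B (fullbad a)) (u, 0) (v, a) (D \<times> {..a})"
  proof (rule near_absorbing_image[OF grid, where \<phi> = "map_prod f id" and s = "rk u"])
    show "inj_on (map_prod f id) ({..n} \<times> {..a})"
      by (rule map_prod_inj_on[OF _ inj_on_id]) (use inj in \<open>auto intro: inj_onI\<close>)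
    show "D \<times> {..a} = map_prod f id ` ({..n} \<times> {..a})"
      unfolding f(1) by (subst map_prod_surj_on[where g = id and B = "{..a}"]) auto
    show "N + a = n + a + 2 * rk u" using *(4) n by simp
    show "(u, 0) = map_prod f id (0, 0)" "(v, a) = map_prod f id (n, a)" using f(2,3) by simp_all
    fix x y :: "nat \<times> nat" assume xy: "x \<in> {..n} \<times> {..a}"
    show "prodrk rk idrk (map_prod f id x) = prodrk idrk idrk x + rk u"
      using f(4) xy by (auto simp: prodrk_def)
    assume xy': "y \<in> {..n} \<times> {..a}"
    have le: "fst x \<le> n" "fst y \<le> n" using xy xy' by auto
    show "map_prod f id x \<le> map_prod f id y" if "x \<le> y"
      using that f(5) le by (simp add: less_eq_prod_def)
    have "2 \<le> n" using *(5) n by simp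
    then have "fullbad n (fst x) (fst y)" if "B (f (fst x)) (f (fst y))"
      using full[OF that le] by (simp add: fullbad_def)
    moreover have "fst x = fst y" if "f (fst x) = f (fst y)" using inj that le by blast
    ultimately show "prodbad (fullbad n) (fullbad a) x y"
      if "prodbad B (fullbad a) (map_prod f id x) (map_prod f id y)"
      using that unfolding prodbad_def by auto
  qed
  show ?thesis
    by (rule near_absorbing_Un[OF D absorbing_prod[OF *(7), of a]]) (use *(1,2) in auto)
qed

section \<open>Explicit decompositions\<close>

fun disjoint_list :: "'a set list \<Rightarrow> bool" where
  "disjoint_list [] \<longleftrightarrow> True"
| "disjoint_list (C # Cs) \<longleftrightarrow> C \<inter> \<Union> (set Cs) = {} \<and> disjoint_list Cs"

lemma sdec_list:
  assumes "\<forall>L\<in>set Ls. linked rk L \<and> rk (fst (hd L)) + rk (snd (last L)) = N \<and>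
      (\<forall>x\<in>segs L. \<forall>y\<in>segs L. \<not> B x y)"
    and "disjoint_list (map segs Ls)"
  shows "sdec rk N B (\<Union> (segs ` set Ls))"
  using assms
proof (induction Ls)
  case (Cons L Ls)
  have "sdec rk N B (segs L)"
    by (rule sdec_single[OF linked_symchain]) (use Cons.prems in auto)
  moreover have "sdec rk N B (\<Union> (segs ` set Ls))" using Cons by auto
  ultimately show ?case using Cons.prems by (auto intro: sdec_Un)
qed (simp add: sdec_empty)

lemma interval_Pair [simp]:
  fixes b :: "'b::order"
  shows "{(l, b)..(h, b)} = {l..h} \<times> {b}"
  by (auto simp: less_eq_prod_def)

declare saturated_left [simp]

text \<open>A chain of five levels with its middle level doubled: this is what remains above the staircase
  from \<open>(0, 0)\<close> to \<open>(3, 3)\<close> in the grid \<open>{..3} \<times> {..3}\<close>, while a three-element chain remains below.\<close>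

definition doubled_chain :: "(nat \<times> nat) set" where
  "doubled_chain = {(0, 1), (0, 2), (0, 3), (1, 2), (1, 3), (2, 3)}"

text \<open>The bad pairs are the two ends of a line \<open>{..c} \<times> {p}\<close>. Four chains
  deal with every point whose first coordinate is \<open>c\<close>. The leftover strip over
  \<open>(1, 3)\<close> and \<open>(2, 3)\<close> stops short of \<open>c\<close>, so hooks
  decompose it.\<close>

lemma doubled_chain_lines:
  assumes "2 \<le> c"
  shows "sdec (prodrk idrk (prodrk idrk idrk)) (c + 6) (prodbad (fullbad c) nobad) ({..c} \<times> doubled_chain)"
proof -
  obtain e where c: "c = e + 2" using assms by (metis le_add_diff_inverse2)
  let ?r = "prodrk idrk (prodrk idrk idrk)"
  let ?Ls = "[[((0, 0, 1), (1, 0, 1)), ((1, 0, 2), (c - 1, 0, 2)), ((c - 1, 0, 3), (c, 0, 3)),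
       ((c, 1, 3), (c, 1, 3)), ((c, 2, 3), (c, 2, 3))],
     [((0, 0, 2), (0, 0, 2)), ((0, 1, 2), (c - 1, 1, 2)), ((c - 1, 1, 3), (c - 1, 1, 3)), ((c - 1, 2, 3), (c - 1, 2, 3))],
     [((2, 0, 1), (c, 0, 1)), ((c, 0, 2), (c, 0, 2)), ((c, 1, 2), (c, 1, 2))],
     [((0, 0, 3), (c - 2, 0, 3)), ((c - 2, 1, 3), (c - 2, 1, 3)), ((c - 2, 2, 3), (c - 2, 2, 3))]]
     :: ((nat \<times> nat \<times> nat) \<times> (nat \<times> nat \<times> nat)) list list"
  have 1: "sdec ?r (c + 6) (prodbad (fullbad c) nobad) (\<Union> (segs ` set ?Ls))"
    by (rule sdec_list) (auto simp: c less_eq_prod_def prodbad_def fullbad_def)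
  have 2: "sdec ?r (c + 6) (prodbad (fullbad c) nobad) ({..<e} \<times> {1, 2 :: nat} \<times> {3 :: nat})"
  proof (cases e)
    case (Suc d)
    show ?thesis
    proof (rule sdec_image[OF sdec_grid[of d 1], where \<phi> = "\<lambda>u. (fst u, snd u + 1, 3)" and s = 4])
      show "{..<e} \<times> {1, 2 :: nat} \<times> {3 :: nat} = (\<lambda>u. (fst u, snd u + 1, 3)) ` ({..d} \<times> {..1})"
      proof (intro equalityI subsetI)
        fix x assume "x \<in> {..<e} \<times> {1, 2 :: nat} \<times> {3 :: nat}"
        then show "x \<in> (\<lambda>u. (fst u, snd u + 1, 3)) ` ({..d} \<times> {..1})"
          by (intro image_eqI[of _ _ "(fst x, fst (snd x) - 1)"]) (auto simp: Suc)
      qed (auto simp: Suc)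
    qed (auto simp: Suc c inj_on_def less_eq_prod_def prodbad_def fullbad_def)
  qed (simp add: sdec_empty)
  show ?thesis
  proof (rule sdec_Un'[OF 1 2])
    show "\<Union> (segs ` set ?Ls) \<inter> ({..<e} \<times> {1, 2 :: nat} \<times> {3 :: nat}) = {}" by (auto simp: c)
    show "{..c} \<times> doubled_chain = \<Union> (segs ` set ?Ls) \<union> {..<e} \<times> {1, 2 :: nat} \<times> {3 :: nat}" (is "_ = ?R")
    proof (intro equalityI subsetI)
      fix z assume "z \<in> {..c} \<times> doubled_chain"
      then obtain x p where "z = (x, p)" "x \<le> c" "p \<in> doubled_chain" by auto
      then show "z \<in> ?R"
        unfolding doubled_chain_def c by (elim insertE emptyE; simp) arith+
    qed (auto simp: c doubled_chain_def)
  qed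
qed

text \<open>Here the zigzags would leave a 2 by 2 square, to which \<open>zigzag_rect\<close> does
  not apply. A staircase along the diagonal is used instead; the two parts on either side of it
  contain no bad pairs and are absorbing.\<close>

lemma near_absorbing_3_3:
  "near_absorbing (prodrk idrk idrk) (3 + 3) (prodbad (fullbad 3) (fullbad 3)) (0, 0) (3, 3) ({..3} \<times> {..3})"
proof -
  let ?r = "prodrk idrk idrk" and ?B = "prodbad (fullbad 3) (fullbad 3)"
  let ?D = "segs [((0, 0), (1, 0)), ((1, 1), (2, 1)), ((2, 2), (3, 2)), ((3, 3), (3, 3))] :: (nat \<times> nat) set"
  let ?C = "segs [((2, 0), (3, 0)), ((3, 1), (3, 1))] :: (nat \<times> nat) set"
  have D: "saturated ?r (0, 0) (3, 3) ?D"
    using linked_saturated[of ?r "[((0, 0), (1, 0)), ((1, 1), (2, 1)), ((2, 2), (3, 2)), ((3, 3), (3, 3))]"]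
    by (simp add: less_eq_prod_def)
  have "saturated ?r (2, 0) (3, 1) ?C"
    using linked_saturated[of ?r "[((2, 0), (3, 0)), ((3, 1), (3, 1))]"]
    by (simp add: less_eq_prod_def)
  then have C: "absorbing ?r (3 + 3) ?B ?C"
    by (rule absorbing_chain) (auto simp: prodbad_def fullbad_def)
  have K: "absorbing ?r (3 + 3) ?B doubled_chain"
  proof (rule absorbingI)
    let ?Ls = "[[((0, 1), (0, 1)), ((0, 2), (0, 2)), ((0, 3), (2, 3))], [((1, 2), (1, 2))]]"
    have "sdec ?r (3 + 3) ?B (\<Union> (segs ` set ?Ls))"
      by (rule sdec_list) (auto simp: less_eq_prod_def prodbad_def fullbad_def)
    moreover have "\<Union> (segs ` set ?Ls) = doubled_chain" unfolding doubled_chain_def by auto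
    ultimately show "sdec ?r (3 + 3) ?B doubled_chain" by simp
    fix c :: nat assume c: "2 \<le> c"
    show "sdec (prodrk idrk ?r) (c + (3 + 3)) (prodbad (fullbad c) ?B) ({..c} \<times> doubled_chain)"
      by (rule sdec_image[OF doubled_chain_lines[OF c], where \<phi> = id and s = 0])
         (auto simp: prodbad_def fullbad_def doubled_chain_def)
  qed
  have R: "absorbing ?r (3 + 3) ?B (?C \<union> doubled_chain)"
    by (rule absorbing_Un[OF C K _ refl]) (auto simp: doubled_chain_def)
  show ?thesis unfolding near_absorbing_def
  proof (rule exI[of _ ?D], rule exI[of _ "?C \<union> doubled_chain"], intro conjI D R)
    show "{..3} \<times> {..3} = ?D \<union> (?C \<union> doubled_chain)"
    proof (intro equalityI subsetI)
      fix z :: "nat \<times> nat" assume "z \<in> {..3} \<times> {..3}"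
      moreover have "{..3 :: nat} = {0, 1, 2, 3}" by auto
      ultimately obtain x y where "z = (x, y)" "x \<in> {0, 1, 2, 3}" "y \<in> {0, 1, 2, 3}" by auto
      then show "z \<in> ?D \<union> (?C \<union> doubled_chain)"
        by (elim insertE emptyE) (simp_all add: doubled_chain_def less_eq_prod_def)
    next
      fix z assume "z \<in> ?D \<union> (?C \<union> doubled_chain)"
      then show "z \<in> {..3} \<times> {..3}"
        by (cases z) (auto simp: doubled_chain_def less_eq_prod_def)
    qed
    show "?D \<inter> (?C \<union> doubled_chain) = {}" by (auto simp: doubled_chain_def less_eq_prod_def)
  qed (auto simp: prodbad_def fullbad_def)
qed

section \<open>Boxes with two long sides and one side of length one\<close>

declare saturated_right [simp]

lemma interval_Pair_right [simp]:
  fixes a :: "'a::order"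
  shows "{(a, l)..(a, h)} = {a} \<times> {l..h}"
  by (auto simp: less_eq_prod_def)

lemma image_shift_Pair:
  fixes k b :: nat
  assumes "k \<le> b"
  shows "(X \<times> {k..b}) \<times> {z} = (\<lambda>u. ((fst u, snd u + k), z)) ` (X \<times> {..b - k})"
proof -
  have "(X \<times> {k..b}) \<times> {z} = (\<lambda>v. (v, z)) ` (\<lambda>u. (fst u, snd u + k)) ` (X \<times> {..b - k})"
    unfolding image_shift[OF assms] by auto
  then show ?thesis by (simp add: image_image)
qed

text \<open>Opposite corners may lie in one chain if the last coordinate changes between them. So
  \<open>?A\<close> runs from \<open>((0, 0), 0)\<close> to \<open>((a, b), 1)\<close>, while the
  corners \<open>((a, b), 0)\<close> and \<open>((0, 0), 1)\<close> go to \<open>?G\<close> and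
  \<open>?D\<close>. The remaining two rectangles, one for each value of the last coordinate, avoid
  first coordinate \<open>a\<close> and second coordinate \<open>0\<close> and hence all bad
  pairs.\<close>

lemma sdec_prod_2:
  assumes "3 \<le> a" "3 \<le> b"
  shows "sdec (prodrk (prodrk idrk idrk) idrk) (a + b + 1)
    (prodbad (prodbad (fullbad a) (fullbad b)) (fullbad 1)) (({..a} \<times> {..b}) \<times> {..1})"
proof -
  obtain a' b' where ab: "a = a' + 3" "b = b' + 3"
    using assms by (metis le_add_diff_inverse2)
  let ?r = "prodrk (prodrk idrk idrk) idrk" and ?B = "prodbad (prodbad (fullbad a) (fullbad b)) (fullbad 1)"
  let ?A = "[(((0, 0), 0), ((1, 0), 0)), (((1, 1), 0), ((a - 1, 1), 0)), (((a - 1, 1), 1), ((a - 1, b - 1), 1)),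
       (((a, b - 1), 1), ((a, b), 1))] :: (((nat \<times> nat) \<times> nat) \<times> ((nat \<times> nat) \<times> nat)) list"
  let ?G = "[(((0, 1), 0), ((0, 2), 0)), (((1, 2), 0), ((a - 1, 2), 0)), (((a - 1, 3), 0), ((a - 1, b), 0)),
       (((a, b), 0), ((a, b), 0))] :: (((nat \<times> nat) \<times> nat) \<times> ((nat \<times> nat) \<times> nat)) list"
  let ?E = "[(((2, 0), 0), ((a, 0), 0)), (((a, 1), 0), ((a, b - 1), 0))] :: (((nat \<times> nat) \<times> nat) \<times> ((nat \<times> nat) \<times> nat)) list"
  let ?Z = "[(((1, 0), 1), ((a, 0), 1)), (((a, 1), 1), ((a, b - 2), 1))] :: (((nat \<times> nat) \<times> nat) \<times> ((nat \<times> nat) \<times> nat)) list"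
  let ?D = "[(((0, 0), 1), ((0, 1), 1)), (((1, 1), 1), ((a - 2, 1), 1)), (((a - 2, 2), 1), ((a - 2, b), 1)),
       (((a - 1, b), 1), ((a - 1, b), 1))] :: (((nat \<times> nat) \<times> nat) \<times> ((nat \<times> nat) \<times> nat)) list"
  have ln: "linked ?r ?A" "linked ?r ?G" "linked ?r ?E" "linked ?r ?Z" "linked ?r ?D"
    by (simp_all add: ab less_eq_prod_def)
  have b1: "\<forall>x\<in>segs ?A. \<forall>y\<in>segs ?A. \<not> ?B x y"
    by (auto simp: ab prodbad_def fullbad_def)
  have b2: "\<forall>x\<in>segs ?G. \<forall>y\<in>segs ?G. \<not> ?B x y"
    by (auto simp: ab prodbad_def fullbad_def)
  have b3: "\<forall>x\<in>segs ?E. \<forall>y\<in>segs ?E. \<not> ?B x y"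
    by (auto simp: ab prodbad_def fullbad_def)
  have b4: "\<forall>x\<in>segs ?Z. \<forall>y\<in>segs ?Z. \<not> ?B x y"
    by (auto simp: ab prodbad_def fullbad_def)
  have b5: "\<forall>x\<in>segs ?D. \<forall>y\<in>segs ?D. \<not> ?B x y"
    by (auto simp: ab prodbad_def fullbad_def)
  have dj: "disjoint_list (map segs [?A, ?G, ?E, ?Z, ?D])"
    by (auto simp: ab)
  have 1: "sdec ?r (a + b + 1) ?B (\<Union> (segs ` set [?A, ?G, ?E, ?Z, ?D]))"
  proof (rule sdec_list[OF _ dj])
    show "\<forall>L\<in>set [?A, ?G, ?E, ?Z, ?D]. linked ?r L \<and> ?r (fst (hd L)) + ?r (snd (last L)) = a + b + 1 \<and>
        (\<forall>x\<in>segs L. \<forall>y\<in>segs L. \<not> ?B x y)"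
      using ln b1 b2 b3 b4 b5 by (simp add: ab)
  qed
  have 2: "sdec ?r (a + b + 1) ?B (({..a - 2} \<times> {3..b}) \<times> {0})"
  proof (rule sdec_image[OF sdec_grid[of "a - 2" "b - 3"], where \<phi> = "\<lambda>u. ((fst u, snd u + 3), 0)" and s = 3])
    show "({..a - 2} \<times> {3..b}) \<times> {0} = (\<lambda>u. ((fst u, snd u + 3), 0)) ` ({..a - 2} \<times> {..b - 3})"
      by (rule image_shift_Pair) (simp add: ab)
  qed (auto simp: ab inj_on_def less_eq_prod_def prodbad_def fullbad_def)
  have 3: "sdec ?r (a + b + 1) ?B (({..a - 3} \<times> {2..b}) \<times> {1})"
  proof (rule sdec_image[OF sdec_grid[of "a - 3" "b - 2"], where \<phi> = "\<lambda>u. ((fst u, snd u + 2), 1)" and s = 3])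
    show "({..a - 3} \<times> {2..b}) \<times> {1} = (\<lambda>u. ((fst u, snd u + 2), 1)) ` ({..a - 3} \<times> {..b - 2})"
      by (rule image_shift_Pair) (simp add: ab)
  qed (auto simp: ab inj_on_def less_eq_prod_def prodbad_def fullbad_def)
  show ?thesis
  proof (rule sdec_Un'[OF 1 sdec_Un'[OF 2 3 _ refl]])
    let ?R1 = "({..a - 2} \<times> {3..b}) \<times> {0 :: nat}" and ?R2 = "({..a - 3} \<times> {2..b}) \<times> {1 :: nat}"
    show "?R1 \<inter> ?R2 = {}" by auto
    show "\<Union> (segs ` set [?A, ?G, ?E, ?Z, ?D]) \<inter> (?R1 \<union> ?R2) = {}"
      by (auto simp: ab less_eq_prod_def)
    show "({..a} \<times> {..b}) \<times> {..1} = \<Union> (segs ` set [?A, ?G, ?E, ?Z, ?D]) \<union> (?R1 \<union> ?R2)" (is "_ = ?R")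
    proof (intro equalityI subsetI)
      fix u :: "(nat \<times> nat) \<times> nat" assume "u \<in> ({..a} \<times> {..b}) \<times> {..1}"
      then obtain x y z where u: "u = ((x, y), z)" and "x \<le> a" "y \<le> b" "z = 0 \<or> z = 1" by fastforce
      have y: "y = 0 \<or> y = 1 \<or> y = 2 \<or> (\<exists>y'. y = y' + 3)" by presburger
      from \<open>z = 0 \<or> z = 1\<close> show "u \<in> ?R"
      proof
        assume "z = 0"
        with y \<open>x \<le> a\<close> \<open>y \<le> b\<close> show ?thesis unfolding u ab
          by (elim disjE exE; simp) arith+
      next
        assume "z = 1"
        with y \<open>x \<le> a\<close> \<open>y \<le> b\<close> show ?thesis unfolding u ab
          by (elim disjE exE; simp) arith+
      qed
    next
      fix u assume "u \<in> ?R"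
      then show "u \<in> ({..a} \<times> {..b}) \<times> {..1}"
        by (simp add: ab) (elim disjE; force)
    qed
  qed
qed

text \<open>The side \<open>{..2}\<close> is too short for the previous construction, whose chain
  \<open>?G\<close> has a segment starting at height \<open>3\<close>. Six chains cover the box. The
  case is needed for the outer factor \<open>c = 2\<close>.\<close>

lemma sdec_prod_2_short:
  assumes "3 \<le> a"
  shows "sdec (prodrk (prodrk idrk idrk) idrk) (a + 2 + 1)
    (prodbad (prodbad (fullbad a) (fullbad 2)) (fullbad 1)) (({..a} \<times> {..2}) \<times> {..1})"
proof -
  obtain e where a: "a = e + 3" using assms by (metis le_add_diff_inverse2)
  let ?r = "prodrk (prodrk idrk idrk) idrk" and ?B = "prodbad (prodbad (fullbad a) (fullbad 2)) (fullbad 1)"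
  let ?Ls = "[[(((0, 0), 0), ((0, 0), 0)), (((0, 1), 0), ((0, 1), 0)), (((0, 1), 1), ((a - 2, 1), 1)),
        (((a - 2, 2), 1), ((a, 2), 1))],
      [(((0, 0), 1), ((a - 1, 0), 1)), (((a - 1, 1), 1), ((a, 1), 1))],
      [(((1, 0), 0), ((1, 0), 0)), (((1, 1), 0), ((a, 1), 0)), (((a, 2), 0), ((a, 2), 0))],
      [(((0, 2), 0), ((a - 1, 2), 0))],
      [(((2, 0), 0), ((a, 0), 0)), (((a, 0), 1), ((a, 0), 1))],
      [(((0, 2), 1), ((a - 3, 2), 1))]] :: (((nat \<times> nat) \<times> nat) \<times> ((nat \<times> nat) \<times> nat)) list list"
  have "sdec ?r (a + 2 + 1) ?B (\<Union> (segs ` set ?Ls))"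
    by (rule sdec_list) (auto simp: a less_eq_prod_def prodbad_def fullbad_def)
  moreover have "({..a} \<times> {..2}) \<times> {..1} = \<Union> (segs ` set ?Ls)" (is "_ = ?R")
  proof (intro equalityI subsetI)
    fix u :: "(nat \<times> nat) \<times> nat" assume "u \<in> ({..a} \<times> {..2}) \<times> {..1}"
    then obtain x y z where u: "u = ((x, y), z)" and "x \<le> a" "y \<le> 2" "z \<le> 1" by fastforce
    have "y = 0 \<or> y = 1 \<or> y = 2" "z = 0 \<or> z = 1" using \<open>y \<le> 2\<close> \<open>z \<le> 1\<close> by arith+
    then show "u \<in> ?R" using \<open>x \<le> a\<close> unfolding u a
      by (elim disjE; simp) arith+
  next
    fix u assume "u \<in> ?R"
    then show "u \<in> ({..a} \<times> {..2}) \<times> {..1}"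
      by (simp add: a) (elim disjE; force)
  qed
  ultimately show ?thesis by simp
qed

text \<open>With the outer factor, \<open>D \<times> {..1}\<close> becomes a box
  \<open>{..n} \<times> {..c} \<times> {..1}\<close>, which has a decomposition without any bad
  pair. The decomposition of \<open>P \<times> {..1}\<close> is a separate premise, since
  \<open>D \<times> {..1}\<close> on its own need not have one.\<close>

lemma near_absorbing_prod_2:
  assumes "near_absorbing rk N B u v P"
    and P: "sdec (prodrk rk idrk) (N + 1) (prodbad B (fullbad 1)) (P \<times> {..1})"
  shows "absorbing (prodrk rk idrk) (N + 1) (prodbad B (fullbad 1)) (P \<times> {..1})"
proof (rule absorbingI[OF P])
  fix c :: nat assume c: "2 \<le> c"
  obtain D R where *: "P = D \<union> R" "D \<inter> R = {}" "saturated rk u v D" "N = rk u + rk v"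
    "rk u + 4 \<le> rk v" "\<forall>x\<in>D. \<forall>y\<in>D. B x y \<longrightarrow> x = u \<and> y = v" "absorbing rk N B R"
    using assms(1) unfolding near_absorbing_def by blast
  obtain f n where f: "D = f ` {..n}" "f 0 = u" "f n = v" "\<forall>x\<le>n. rk (f x) = rk u + x"
     "\<forall>x y. x \<le> y \<longrightarrow> y \<le> n \<longrightarrow> f x \<le> f y" using *(3) unfolding saturated_def by blast
  have n: "rk v = rk u + n" using f(3,4) by blast
  have n4: "4 \<le> n" using *(5) n by simp
  have inj: "x = y" if "f x = f y" "x \<le> n" "y \<le> n" for x y
    using f(4) that by (metis add_left_cancel)
  have full: "fullbad n x y" if "B (f x) (f y)" "x \<le> n" "y \<le> n" for x y
  proof -
    have "f x = f 0" "f y = f n" using *(6) that f(2,3) unfolding f(1) by auto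
    then have "x = 0" "y = n" using inj[of x 0] inj[of y n] that by auto
    then show ?thesis using n4 by (simp add: fullbad_def)
  qed
  let ?r = "prodrk idrk (prodrk rk idrk)" and ?B = "prodbad (fullbad c) (prodbad B (fullbad 1))"
  have s: "sdec (prodrk (prodrk idrk idrk) idrk) (n + c + 1)
      (prodbad (prodbad (fullbad n) (fullbad c)) (fullbad 1)) (({..n} \<times> {..c}) \<times> {..1})"
  proof (cases "c = 2")
    case True then show ?thesis using sdec_prod_2_short[of n] n4 by simp
  next
    case False then show ?thesis using sdec_prod_2[of n c] n4 c by simp
  qed
  have D: "sdec ?r (c + (N + 1)) ?B ({..c} \<times> D \<times> {..1})"
  proof (rule sdec_image[OF s, where \<phi> = "\<lambda>w. (snd (fst w), f (fst (fst w)), snd w)" and s = "rk u"])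
    show "inj_on (\<lambda>w. (snd (fst w), f (fst (fst w)), snd w)) (({..n} \<times> {..c}) \<times> {..1})"
      using inj by (intro inj_onI) (auto simp: prod_eq_iff)
    show "{..c} \<times> D \<times> {..1} = (\<lambda>w. (snd (fst w), f (fst (fst w)), snd w)) ` (({..n} \<times> {..c}) \<times> {..1})"
      unfolding f(1) by force
    show "c + (N + 1) = n + c + 1 + 2 * rk u" using *(4) n by simp
    fix x y :: "(nat \<times> nat) \<times> nat" assume x: "x \<in> ({..n} \<times> {..c}) \<times> {..1}"
    show "?r (snd (fst x), f (fst (fst x)), snd x) = prodrk (prodrk idrk idrk) idrk x + rk u"
      using f(4) x by (auto simp: prodrk_def)
    assume y: "y \<in> ({..n} \<times> {..c}) \<times> {..1}"
    have le: "fst (fst x) \<le> n" "fst (fst y) \<le> n" using x y by auto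
    show "(snd (fst x), f (fst (fst x)), snd x) \<le> (snd (fst y), f (fst (fst y)), snd y)" if "x \<le> y"
      using that f(5) le by (simp add: less_eq_prod_def)
    show "prodbad (prodbad (fullbad n) (fullbad c)) (fullbad 1) x y"
      if "?B (snd (fst x), f (fst (fst x)), snd x) (snd (fst y), f (fst (fst y)), snd y)"
      using that full[OF _ le] inj[OF _ le] unfolding prodbad_def by (auto simp: prod_eq_iff)
  qed
  have R: "sdec ?r (c + (N + 1)) ?B ({..c} \<times> R \<times> {..1})"
    using absorbing_prod[OF *(7), of 1] unfolding absorbing_def by blast
  show "sdec ?r (c + (N + 1)) ?B ({..c} \<times> P \<times> {..1})"
    by (rule sdec_Un'[OF D R]) (use *(1,2) in auto)
qed

lemma near_absorbing_square:
  assumes "odd a" "odd b" "b \<le> a" "2 \<le> b"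
  shows "near_absorbing (prodrk idrk idrk) (a + b) (prodbad (fullbad a) (fullbad b)) (0, 0) (a, b) ({..a} \<times> {..b})"
proof (cases "a = 3")
  case True
  then have "b = 3" using assms by presburger
  then show ?thesis using near_absorbing_3_3 True by simp
next
  case False
  then have "4 \<le> a" using assms by presburger
  then show ?thesis using near_absorbing_grid assms by simp
qed

lemma absorbing_square_2:
  assumes "odd a" "odd b" "b \<le> a" "2 \<le> b"
  shows "absorbing (prodrk (prodrk idrk idrk) idrk) (a + b + 1)
    (prodbad (prodbad (fullbad a) (fullbad b)) (fullbad 1)) (({..a} \<times> {..b}) \<times> {..1})"
proof (rule near_absorbing_prod_2[OF near_absorbing_square[OF assms]])
  have "3 \<le> b" using assms by presburger
  then show "sdec (prodrk (prodrk idrk idrk) idrk) (a + b + 1)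
    (prodbad (prodbad (fullbad a) (fullbad b)) (fullbad 1)) (({..a} \<times> {..b}) \<times> {..1})"
    using assms(3) by (intro sdec_prod_2) auto
qed

section \<open>The five-dimensional cube\<close>

abbreviation (input) rank5 :: "nat \<times> nat \<times> nat \<times> nat \<times> nat \<Rightarrow> nat" where
  "rank5 \<equiv> prodrk idrk (prodrk idrk (prodrk idrk (prodrk idrk idrk)))"

text \<open>A six-element chain with a second two-element chain beside its middle. In the decompositions below,
  found by computer search, no line \<open>{..c} \<times> {p}\<close> lies in a single chain. The one for \<open>c \<ge> 5\<close> is the one
  for \<open>c = 5\<close> stretched along the middle level, which meets every line exactly once.\<close>

definition spindle :: "(nat \<times> nat \<times> nat \<times> nat \<times> nat) set" where
  "spindle = {(0, 0, 0, 0, 0), (1, 0, 0, 0, 0), (1, 1, 0, 0, 0), (1, 1, 1, 0, 0), (1, 0, 1, 0, 0), (1, 0, 1, 1, 0), (1, 1, 1, 1, 0), (1, 1, 1, 1, 1)}"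

lemma spindle_lines_2:
  shows "sdec (prodrk idrk rank5) (2 + 5) (prodbad (fullbad 2) nobad) ({..2} \<times> spindle)"
proof -
  let ?Ls = "[[((0, 0, 0, 0, 0, 0), (0, 0, 0, 0, 0, 0)), ((0, 1, 0, 0, 0, 0), (0, 1, 0, 0, 0, 0)), ((0, 1, 0, 1, 0, 0), (0, 1, 0, 1, 0, 0)), ((0, 1, 0, 1, 1, 0), (1, 1, 0, 1, 1, 0)), ((1, 1, 1, 1, 1, 0), (1, 1, 1, 1, 1, 0)), ((1, 1, 1, 1, 1, 1), (2, 1, 1, 1, 1, 1))],
      [((1, 0, 0, 0, 0, 0), (1, 0, 0, 0, 0, 0)), ((1, 1, 0, 0, 0, 0), (1, 1, 0, 0, 0, 0)), ((1, 1, 0, 1, 0, 0), (2, 1, 0, 1, 0, 0)), ((2, 1, 0, 1, 1, 0), (2, 1, 0, 1, 1, 0)), ((2, 1, 1, 1, 1, 0), (2, 1, 1, 1, 1, 0))],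
      [((2, 0, 0, 0, 0, 0), (2, 0, 0, 0, 0, 0)), ((2, 1, 0, 0, 0, 0), (2, 1, 0, 0, 0, 0)), ((2, 1, 1, 0, 0, 0), (2, 1, 1, 0, 0, 0)), ((2, 1, 1, 1, 0, 0), (2, 1, 1, 1, 0, 0))],
      [((0, 1, 1, 0, 0, 0), (0, 1, 1, 0, 0, 0)), ((0, 1, 1, 1, 0, 0), (0, 1, 1, 1, 0, 0)), ((0, 1, 1, 1, 1, 0), (0, 1, 1, 1, 1, 0)), ((0, 1, 1, 1, 1, 1), (0, 1, 1, 1, 1, 1))],
      [((1, 1, 1, 0, 0, 0), (1, 1, 1, 0, 0, 0)), ((1, 1, 1, 1, 0, 0), (1, 1, 1, 1, 0, 0))]]
      :: ((nat \<times> nat \<times> nat \<times> nat \<times> nat \<times> nat) \<times> (nat \<times> nat \<times> nat \<times> nat \<times> nat \<times> nat)) list list"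
  have "sdec (prodrk idrk rank5) (2 + 5) (prodbad (fullbad 2) nobad) (\<Union> (segs ` set ?Ls))"
    by (rule sdec_list) (auto simp: less_eq_prod_def prodbad_def fullbad_def)
  moreover have "{..2} \<times> spindle = \<Union> (segs ` set ?Ls)" (is "_ = ?R")
  proof (intro equalityI subsetI)
    fix z :: "nat \<times> nat \<times> nat \<times> nat \<times> nat \<times> nat" assume "z \<in> {..2} \<times> spindle"
    then obtain x p where "z = (x, p)" "x \<le> 2" "p \<in> spindle" by auto
    then show "z \<in> ?R" unfolding spindle_def by (elim insertE emptyE; simp) arith+
  qed (auto simp: spindle_def)
  ultimately show ?thesis by simp
qed

lemma spindle_lines_3:
  shows "sdec (prodrk idrk rank5) (3 + 5) (prodbad (fullbad 3) nobad) ({..3} \<times> spindle)"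
proof -
  let ?Ls = "[[((0, 0, 0, 0, 0, 0), (0, 0, 0, 0, 0, 0)), ((0, 1, 0, 0, 0, 0), (0, 1, 0, 0, 0, 0)), ((0, 1, 0, 1, 0, 0), (0, 1, 0, 1, 0, 0)), ((0, 1, 0, 1, 1, 0), (1, 1, 0, 1, 1, 0)), ((1, 1, 1, 1, 1, 0), (1, 1, 1, 1, 1, 0)), ((1, 1, 1, 1, 1, 1), (3, 1, 1, 1, 1, 1))],
      [((1, 0, 0, 0, 0, 0), (1, 0, 0, 0, 0, 0)), ((1, 1, 0, 0, 0, 0), (1, 1, 0, 0, 0, 0)), ((1, 1, 0, 1, 0, 0), (2, 1, 0, 1, 0, 0)), ((2, 1, 0, 1, 1, 0), (2, 1, 0, 1, 1, 0)), ((2, 1, 1, 1, 1, 0), (3, 1, 1, 1, 1, 0))],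
      [((2, 0, 0, 0, 0, 0), (3, 0, 0, 0, 0, 0)), ((3, 1, 0, 0, 0, 0), (3, 1, 0, 0, 0, 0)), ((3, 1, 0, 1, 0, 0), (3, 1, 0, 1, 0, 0)), ((3, 1, 0, 1, 1, 0), (3, 1, 0, 1, 1, 0))],
      [((0, 1, 1, 0, 0, 0), (1, 1, 1, 0, 0, 0)), ((1, 1, 1, 1, 0, 0), (3, 1, 1, 1, 0, 0))],
      [((2, 1, 0, 0, 0, 0), (2, 1, 0, 0, 0, 0)), ((2, 1, 1, 0, 0, 0), (3, 1, 1, 0, 0, 0))],
      [((0, 1, 1, 1, 0, 0), (0, 1, 1, 1, 0, 0)), ((0, 1, 1, 1, 1, 0), (0, 1, 1, 1, 1, 0)), ((0, 1, 1, 1, 1, 1), (0, 1, 1, 1, 1, 1))]]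
      :: ((nat \<times> nat \<times> nat \<times> nat \<times> nat \<times> nat) \<times> (nat \<times> nat \<times> nat \<times> nat \<times> nat \<times> nat)) list list"
  have "sdec (prodrk idrk rank5) (3 + 5) (prodbad (fullbad 3) nobad) (\<Union> (segs ` set ?Ls))"
    by (rule sdec_list) (auto simp: less_eq_prod_def prodbad_def fullbad_def)
  moreover have "{..3} \<times> spindle = \<Union> (segs ` set ?Ls)" (is "_ = ?R")
  proof (intro equalityI subsetI)
    fix z :: "nat \<times> nat \<times> nat \<times> nat \<times> nat \<times> nat" assume "z \<in> {..3} \<times> spindle"
    then obtain x p where "z = (x, p)" "x \<le> 3" "p \<in> spindle" by auto
    then show "z \<in> ?R" unfolding spindle_def by (elim insertE emptyE; simp) arith+
  qed (auto simp: spindle_def)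
  ultimately show ?thesis by simp
qed

lemma spindle_lines_4:
  shows "sdec (prodrk idrk rank5) (4 + 5) (prodbad (fullbad 4) nobad) ({..4} \<times> spindle)"
proof -
  let ?Ls = "[[((0, 0, 0, 0, 0, 0), (0, 0, 0, 0, 0, 0)), ((0, 1, 0, 0, 0, 0), (0, 1, 0, 0, 0, 0)), ((0, 1, 0, 1, 0, 0), (0, 1, 0, 1, 0, 0)), ((0, 1, 0, 1, 1, 0), (1, 1, 0, 1, 1, 0)), ((1, 1, 1, 1, 1, 0), (1, 1, 1, 1, 1, 0)), ((1, 1, 1, 1, 1, 1), (4, 1, 1, 1, 1, 1))],
      [((1, 0, 0, 0, 0, 0), (1, 0, 0, 0, 0, 0)), ((1, 1, 0, 0, 0, 0), (1, 1, 0, 0, 0, 0)), ((1, 1, 0, 1, 0, 0), (2, 1, 0, 1, 0, 0)), ((2, 1, 0, 1, 1, 0), (3, 1, 0, 1, 1, 0)), ((3, 1, 1, 1, 1, 0), (4, 1, 1, 1, 1, 0))],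
      [((2, 0, 0, 0, 0, 0), (2, 0, 0, 0, 0, 0)), ((2, 1, 0, 0, 0, 0), (3, 1, 0, 0, 0, 0)), ((3, 1, 0, 1, 0, 0), (4, 1, 0, 1, 0, 0)), ((4, 1, 0, 1, 1, 0), (4, 1, 0, 1, 1, 0))],
      [((0, 1, 1, 0, 0, 0), (3, 1, 1, 0, 0, 0)), ((3, 1, 1, 1, 0, 0), (4, 1, 1, 1, 0, 0))],
      [((3, 0, 0, 0, 0, 0), (4, 0, 0, 0, 0, 0)), ((4, 1, 0, 0, 0, 0), (4, 1, 0, 0, 0, 0)), ((4, 1, 1, 0, 0, 0), (4, 1, 1, 0, 0, 0))],
      [((0, 1, 1, 1, 0, 0), (2, 1, 1, 1, 0, 0)), ((2, 1, 1, 1, 1, 0), (2, 1, 1, 1, 1, 0))],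
      [((0, 1, 1, 1, 1, 0), (0, 1, 1, 1, 1, 0)), ((0, 1, 1, 1, 1, 1), (0, 1, 1, 1, 1, 1))]]
      :: ((nat \<times> nat \<times> nat \<times> nat \<times> nat \<times> nat) \<times> (nat \<times> nat \<times> nat \<times> nat \<times> nat \<times> nat)) list list"
  have "sdec (prodrk idrk rank5) (4 + 5) (prodbad (fullbad 4) nobad) (\<Union> (segs ` set ?Ls))"
    by (rule sdec_list) (auto simp: less_eq_prod_def prodbad_def fullbad_def)
  moreover have "{..4} \<times> spindle = \<Union> (segs ` set ?Ls)" (is "_ = ?R")
  proof (intro equalityI subsetI)
    fix z :: "nat \<times> nat \<times> nat \<times> nat \<times> nat \<times> nat" assume "z \<in> {..4} \<times> spindle"
    then obtain x p where "z = (x, p)" "x \<le> 4" "p \<in> spindle" by auto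
    then show "z \<in> ?R" unfolding spindle_def by (elim insertE emptyE; simp) arith+
  qed (auto simp: spindle_def)
  ultimately show ?thesis by simp
qed

lemma spindle_lines_long:
  assumes "5 \<le> c"
  shows "sdec (prodrk idrk rank5) (c + 5) (prodbad (fullbad c) nobad) ({..c} \<times> spindle)"
proof -
  obtain e where c: "c = e + 5" using assms by (metis le_add_diff_inverse2)
  let ?Ls = "[[((0, 0, 0, 0, 0, 0), (0, 0, 0, 0, 0, 0)), ((0, 1, 0, 0, 0, 0), (0, 1, 0, 0, 0, 0)), ((0, 1, 1, 0, 0, 0), (0, 1, 1, 0, 0, 0)), ((0, 1, 1, 1, 0, 0), (0, 1, 1, 1, 0, 0)), ((0, 1, 1, 1, 1, 0), (c - 4, 1, 1, 1, 1, 0)), ((c - 4, 1, 1, 1, 1, 1), (c, 1, 1, 1, 1, 1))],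
      [((1, 0, 0, 0, 0, 0), (1, 0, 0, 0, 0, 0)), ((1, 1, 0, 0, 0, 0), (1, 1, 0, 0, 0, 0)), ((1, 1, 1, 0, 0, 0), (c - 1, 1, 1, 0, 0, 0)), ((c - 1, 1, 1, 1, 0, 0), (c - 1, 1, 1, 1, 0, 0)), ((c - 1, 1, 1, 1, 1, 0), (c, 1, 1, 1, 1, 0))],
      [((2, 0, 0, 0, 0, 0), (c, 0, 0, 0, 0, 0)), ((c, 1, 0, 0, 0, 0), (c, 1, 0, 0, 0, 0)), ((c, 1, 1, 0, 0, 0), (c, 1, 1, 0, 0, 0)), ((c, 1, 1, 1, 0, 0), (c, 1, 1, 1, 0, 0))],
      [((0, 1, 0, 1, 0, 0), (c - 2, 1, 0, 1, 0, 0)), ((c - 2, 1, 0, 1, 1, 0), (c, 1, 0, 1, 1, 0))],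
      [((2, 1, 0, 0, 0, 0), (c - 1, 1, 0, 0, 0, 0)), ((c - 1, 1, 0, 1, 0, 0), (c, 1, 0, 1, 0, 0))],
      [((0, 1, 0, 1, 1, 0), (c - 3, 1, 0, 1, 1, 0)), ((c - 3, 1, 1, 1, 1, 0), (c - 2, 1, 1, 1, 1, 0))],
      [((1, 1, 1, 1, 0, 0), (c - 2, 1, 1, 1, 0, 0))],
      [((0, 1, 1, 1, 1, 1), (c - 5, 1, 1, 1, 1, 1))]]
      :: ((nat \<times> nat \<times> nat \<times> nat \<times> nat \<times> nat) \<times> (nat \<times> nat \<times> nat \<times> nat \<times> nat \<times> nat)) list list"
  have "sdec (prodrk idrk rank5) (c + 5) (prodbad (fullbad c) nobad) (\<Union> (segs ` set ?Ls))"
    by (rule sdec_list) (auto simp: c less_eq_prod_def prodbad_def fullbad_def)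
  moreover have "{..c} \<times> spindle = \<Union> (segs ` set ?Ls)" (is "_ = ?R")
  proof (intro equalityI subsetI)
    fix z :: "nat \<times> nat \<times> nat \<times> nat \<times> nat \<times> nat" assume "z \<in> {..c} \<times> spindle"
    then obtain x p where "z = (x, p)" "x \<le> c" "p \<in> spindle" by auto
    then show "z \<in> ?R" unfolding spindle_def c by (elim insertE emptyE; simp) arith+
  qed (auto simp: spindle_def c)
  ultimately show ?thesis by simp
qed

lemma absorbing_spindle: "absorbing rank5 5 nobad spindle"
proof (rule absorbingI)
  let ?Ls = "map (map (\<lambda>p. (p, p)))
    [[(0, 0, 0, 0, 0), (1, 0, 0, 0, 0), (1, 1, 0, 0, 0), (1, 1, 1, 0, 0), (1, 1, 1, 1, 0), (1, 1, 1, 1, 1)],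
     [(1, 0, 1, 0, 0), (1, 0, 1, 1, 0)]]
    :: ((nat \<times> nat \<times> nat \<times> nat \<times> nat) \<times> (nat \<times> nat \<times> nat \<times> nat \<times> nat)) list list"
  have "sdec rank5 5 nobad (\<Union> (segs ` set ?Ls))"
    by (rule sdec_list) (auto simp: less_eq_prod_def)
  moreover have "\<Union> (segs ` set ?Ls) = spindle" by (auto simp: spindle_def)
  ultimately show "sdec rank5 5 nobad spindle" by simp
  fix c :: nat assume "2 \<le> c"
  then consider "c = 2" | "c = 3" | "c = 4" | "5 \<le> c" by linarith
  then show "sdec (prodrk idrk rank5) (c + 5) (prodbad (fullbad c) nobad) ({..c} \<times> spindle)"
    by cases (use spindle_lines_2 spindle_lines_3 spindle_lines_4 spindle_lines_long in auto)
qed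

abbreviation (input) bit :: "nat set" where "bit \<equiv> {..1}"

text \<open>The four sets complementing the spindle are rotations of one another; the fifth rotation is the
  spindle without its two endpoints.\<close>

lemma absorbing_cube5: "absorbing rank5 5 nobad (bit \<times> bit \<times> bit \<times> bit \<times> bit)"
proof -
  let ?P = "{..2} \<times> {..1} :: (nat \<times> nat) set"
  have g: "absorbing (prodrk idrk idrk) (2 + 1) (prodbad nobad (fullbad 1)) ?P"
    by (rule absorbing_prod[OF absorbing_nat]) simp
  have P: "?P = {(0, 0), (1, 0), (2, 0), (0, 1), (1, 1), (2, 1)}"
    by (auto simp: le_Suc_eq numeral_2_eq_2)
  \<comment> \<open>The bits \<open>min x 1\<close> and \<open>x - 1\<close> encode
    \<open>x \<le> 2\<close> as 00, 10, 11, so \<open>f1\<close> covers the words that begin with 01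
    and do not end with 01. A nonconstant cyclic word of length five contains 01 once, or twice at
    cyclic distances two and three; in the latter case exactly one occurrence satisfies the
    condition. Hence the five rotations partition the nonconstant words.\<close>
  define f1 :: "nat \<times> nat \<Rightarrow> nat \<times> nat \<times> nat \<times> nat \<times> nat"
    where "f1 u = (0, 1, snd u, min (fst u) 1, fst u - 1)" for u
  define f2 :: "nat \<times> nat \<Rightarrow> nat \<times> nat \<times> nat \<times> nat \<times> nat"
    where "f2 u = (fst u - 1, 0, 1, snd u, min (fst u) 1)" for u
  define f3 :: "nat \<times> nat \<Rightarrow> nat \<times> nat \<times> nat \<times> nat \<times> nat"
    where "f3 u = (min (fst u) 1, fst u - 1, 0, 1, snd u)" for u
  define f4 :: "nat \<times> nat \<Rightarrow> nat \<times> nat \<times> nat \<times> nat \<times> nat"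
    where "f4 u = (snd u, min (fst u) 1, fst u - 1, 0, 1)" for u
  have a: "absorbing rank5 5 nobad (f ` ?P)" if "f \<in> {f1, f2, f3, f4}" for f
    \<comment> \<open>The two fixed bits 0 and 1 raise the rank by one, and
      \<open>5 = (2 + 1) + 2 * 1\<close>.\<close>
    by (rule absorbing_image[OF g, where s = 1])
       (use that in \<open>auto simp: f1_def f2_def f3_def f4_def P inj_on_def less_eq_prod_def\<close>)
  let ?Q = "f1 ` ?P \<union> (f2 ` ?P \<union> (f3 ` ?P \<union> f4 ` ?P))"
  have "absorbing rank5 5 nobad (f3 ` ?P \<union> f4 ` ?P)"
    by (rule absorbing_Un[OF a a _ refl]) (auto simp: f3_def f4_def P)
  then have "absorbing rank5 5 nobad (f2 ` ?P \<union> (f3 ` ?P \<union> f4 ` ?P))"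
    by (rule absorbing_Un[OF a _ _ refl, rotated]) (auto simp: f2_def f3_def f4_def P)
  then have Q: "absorbing rank5 5 nobad ?Q"
    by (rule absorbing_Un[OF a _ _ refl, rotated]) (auto simp: f1_def f2_def f3_def f4_def P)
  show ?thesis
  proof (rule absorbing_Un[OF absorbing_spindle Q])
    show "spindle \<inter> ?Q = {}"
      unfolding spindle_def P by (simp add: f1_def f2_def f3_def f4_def)
    have bit: "bit = {0, 1}" by auto
    show "bit \<times> bit \<times> bit \<times> bit \<times> bit = spindle \<union> ?Q"
    proof
      show "spindle \<union> ?Q \<subseteq> bit \<times> bit \<times> bit \<times> bit \<times> bit"
        unfolding spindle_def P unfolding bit by (simp add: f1_def f2_def f3_def f4_def)
      show "bit \<times> bit \<times> bit \<times> bit \<times> bit \<subseteq> spindle \<union> ?Q"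
        unfolding spindle_def P unfolding bit by (simp add: f1_def f2_def f3_def f4_def)
    qed
  qed
qed

section \<open>Boxes\<close>

definition box :: "nat set \<Rightarrow> (nat \<Rightarrow> nat) \<Rightarrow> (nat \<Rightarrow> nat) set" where
  "box I a = {x. (\<forall>i\<in>I. x i \<le> a i) \<and> (\<forall>i. i \<notin> I \<longrightarrow> x i = 0)}"

text \<open>No index set occurs: points of a box vanish outside it, so the condition is automatic
  there, and one relation serves all boxes with the same \<open>a\<close>.\<close>

definition boxbad :: "(nat \<Rightarrow> nat) \<Rightarrow> (nat \<Rightarrow> nat) \<Rightarrow> (nat \<Rightarrow> nat) \<Rightarrow> bool" where
  "boxbad a x y \<longleftrightarrow> x \<noteq> y \<and> (\<forall>i. x i = y i \<or> 2 \<le> a i \<and> x i = 0 \<and> y i = a i)"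

text \<open>The absorption lemmas add factors one by one and yield nested pairs.
  \<open>\<psi>\<close> identifies such a nested product with a box over a set of indices; the
  conditions are those needed to transfer decompositions along \<open>\<psi>\<close>.\<close>

definition embeds :: "nat set \<Rightarrow> (nat \<Rightarrow> nat) \<Rightarrow> ('a::order \<Rightarrow> nat) \<Rightarrow> ('a \<Rightarrow> 'a \<Rightarrow> bool) \<Rightarrow>
    'a set \<Rightarrow> ('a \<Rightarrow> nat \<Rightarrow> nat) \<Rightarrow> bool" where
  "embeds I a rk B X \<psi> \<longleftrightarrow> finite I \<and> inj_on \<psi> X \<and> box I a = \<psi> ` X \<and>
     (\<forall>x\<in>X. sum (\<psi> x) I = rk x) \<and>
     (\<forall>x\<in>X. \<forall>y\<in>X. (x \<le> y \<longrightarrow> \<psi> x \<le> \<psi> y) \<and> (boxbad a (\<psi> x) (\<psi> y) \<longrightarrow> B x y))"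

lemma embedsD:
  assumes "embeds I a rk B X \<psi>"
  shows "finite I" "inj_on \<psi> X" "box I a = \<psi> ` X" "\<And>x. x \<in> X \<Longrightarrow> sum (\<psi> x) I = rk x"
    "\<And>x y. x \<in> X \<Longrightarrow> y \<in> X \<Longrightarrow> x \<le> y \<Longrightarrow> \<psi> x \<le> \<psi> y"
    "\<And>x y. x \<in> X \<Longrightarrow> y \<in> X \<Longrightarrow> boxbad a (\<psi> x) (\<psi> y) \<Longrightarrow> B x y"
  using assms unfolding embeds_def by metis+

lemma embeds_single: "embeds {i} a idrk (fullbad (a i)) {..a i} (\<lambda>x. (\<lambda>_. 0)(i := x))"
proof -
  have im: "box {i} a = (\<lambda>x. (\<lambda>_. 0)(i := x)) ` {..a i}"
  proof (intro equalityI subsetI)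
    fix f assume "f \<in> box {i} a"
    then show "f \<in> (\<lambda>x. (\<lambda>_. 0)(i := x)) ` {..a i}"
      by (intro image_eqI[of _ _ "f i"]) (auto simp: box_def)
  qed (auto simp: box_def)
  have inj: "inj_on (\<lambda>x. (\<lambda>_. 0)(i := x)) {..a i}"
    by (intro inj_onI) (metis fun_upd_same)
  have bad: "fullbad (a i) x y" if "boxbad a ((\<lambda>_. 0)(i := x)) ((\<lambda>_. 0)(i := y))" for x y
  proof -
    have "x \<noteq> y" using that by (auto simp: boxbad_def)
    moreover have "x = y \<or> 2 \<le> a i \<and> x = 0 \<and> y = a i"
      using that unfolding boxbad_def by (metis fun_upd_same)
    ultimately show ?thesis by (simp add: fullbad_def)
  qed
  show ?thesis unfolding embeds_def
  proof (intro conjI ballI impI im inj bad)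
    show "(\<lambda>_. 0)(i := x) \<le> (\<lambda>_. 0)(i := y)" if "x \<le> y" for x y :: nat
      using that by (simp add: le_fun_def)
  qed simp_all
qed

lemma embeds_prod:
  assumes "embeds I a rk B X \<psi>" "i \<notin> I"
  shows "embeds (insert i I) a (prodrk rk idrk) (prodbad B (fullbad (a i))) (X \<times> {..a i})
    (\<lambda>u. (\<psi> (fst u))(i := snd u))"
proof -
  note \<psi> = embedsD[OF assms(1)]
  have z: "\<psi> x i = 0" if "x \<in> X" for x
  proof -
    have "\<psi> x \<in> box I a" unfolding \<psi>(3) using that by blast
    then show ?thesis using assms(2) by (simp add: box_def)
  qed
  have eq: "\<psi> x = \<psi> y \<and> t = s" if "(\<psi> x)(i := t) = (\<psi> y)(i := s)" "x \<in> X" "y \<in> X" for x y t s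
  proof -
    have "t = s" using fun_cong[OF that(1), of i] by simp
    moreover have "\<psi> x j = \<psi> y j" for j
      using fun_cong[OF that(1), of j] z[OF that(2)] z[OF that(3)] by (cases "j = i") auto
    ultimately show ?thesis by auto
  qed
  have inj: "inj_on (\<lambda>u. (\<psi> (fst u))(i := snd u)) (X \<times> {..a i})"
  proof (intro inj_onI)
    fix u v assume u: "u \<in> X \<times> {..a i}" "v \<in> X \<times> {..a i}"
      "(\<psi> (fst u))(i := snd u) = (\<psi> (fst v))(i := snd v)"
    have X: "fst u \<in> X" "fst v \<in> X" using u(1,2) by auto
    have "\<psi> (fst u) = \<psi> (fst v)" "snd u = snd v" using eq[OF u(3) X] by blast+
    then show "u = v" using inj_onD[OF \<psi>(2) _ X] by (simp add: prod_eq_iff)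
  qed
  have im: "box (insert i I) a = (\<lambda>u. (\<psi> (fst u))(i := snd u)) ` (X \<times> {..a i})"
  proof (intro equalityI subsetI)
    fix f assume f: "f \<in> box (insert i I) a"
    then have "f(i := 0) \<in> box I a" using assms(2) by (auto simp: box_def)
    then obtain x where x: "x \<in> X" "f(i := 0) = \<psi> x" unfolding \<psi>(3) by blast
    have "f = (\<psi> x)(i := f i)" unfolding x(2)[symmetric] by simp
    moreover have "f i \<le> a i" using f by (simp add: box_def)
    ultimately show "f \<in> (\<lambda>u. (\<psi> (fst u))(i := snd u)) ` (X \<times> {..a i})"
      using x(1) by (intro image_eqI[of _ _ "(x, f i)"]) simp_all
  next
    fix f assume "f \<in> (\<lambda>u. (\<psi> (fst u))(i := snd u)) ` (X \<times> {..a i})"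
    then obtain x t where "f = (\<psi> x)(i := t)" "x \<in> X" "t \<le> a i" by auto
    moreover have "\<psi> x \<in> box I a" unfolding \<psi>(3) using \<open>x \<in> X\<close> by blast
    ultimately show "f \<in> box (insert i I) a" by (auto simp: box_def)
  qed
  have rk: "sum ((\<psi> x)(i := t)) (insert i I) = rk x + t" if "x \<in> X" for x t
  proof -
    have "sum ((\<psi> x)(i := t)) I = sum (\<psi> x) I" using assms(2) by (intro sum.cong) auto
    then show ?thesis using \<psi>(1) assms(2) \<psi>(4)[OF that] by simp
  qed
  have bad: "prodbad B (fullbad (a i)) (x, t) (y, s)"
    if b: "boxbad a ((\<psi> x)(i := t)) ((\<psi> y)(i := s))" and xy: "x \<in> X" "y \<in> X" for x y t s
  proof -
    have 1: "\<psi> x j = \<psi> y j \<or> 2 \<le> a j \<and> \<psi> x j = 0 \<and> \<psi> y j = a j" for j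
      using b z[OF xy(1)] z[OF xy(2)] unfolding boxbad_def by (cases "j = i") (auto dest: spec[of _ j])
    have 2: "t = s \<or> fullbad (a i) t s"
      using b unfolding boxbad_def fullbad_def by (metis fun_upd_same)
    have 3: "x = y \<or> B x y"
      using 1 \<psi>(6)[OF xy] \<psi>(2) xy unfolding boxbad_def by (auto simp: inj_on_def)
    have "\<not> (x = y \<and> t = s)" using b by (auto simp: boxbad_def)
    then show ?thesis using 2 3 by (auto simp: prodbad_def)
  qed
  have mono: "(\<psi> x)(i := t) \<le> (\<psi> y)(i := s)" if "x \<in> X" "y \<in> X" "x \<le> y" "t \<le> s" for x y t s
    using \<psi>(5)[OF that(1-3)] that(4) by (auto simp: le_fun_def)
  show ?thesis unfolding embeds_def
  proof (intro conjI ballI impI im inj)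
    show "finite (insert i I)" using \<psi>(1) by simp
  next
    fix u assume u: "u \<in> X \<times> {..a i}"
    show "sum ((\<psi> (fst u))(i := snd u)) (insert i I) = prodrk rk idrk u"
      using rk[of "fst u" "snd u"] u by (auto simp: prodrk_def)
    fix v assume v: "v \<in> X \<times> {..a i}"
    show "(\<psi> (fst u))(i := snd u) \<le> (\<psi> (fst v))(i := snd v)" if "u \<le> v"
      using that u v by (intro mono) (auto simp: less_eq_prod_def)
    show "prodbad B (fullbad (a i)) u v"
      if "boxbad a ((\<psi> (fst u))(i := snd u)) ((\<psi> (fst v))(i := snd v))"
      using bad[OF that] u v by auto
  qed
qed

lemma embeds_absorbing:
  assumes "embeds I a rk B X \<psi>" "absorbing rk N B X"
  shows "absorbing (\<lambda>x. sum x I) N (boxbad a) (box I a)"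
proof -
  note \<psi> = embedsD[OF assms(1)]
  show ?thesis
    by (rule absorbing_image[OF assms(2) \<psi>(2) _ _ _ _ \<psi>(3), where s = 0]) (use \<psi>(4-6) in simp_all)
qed

lemma embeds_near_absorbing:
  assumes "embeds I a rk B X \<psi>" "near_absorbing rk N B u v X"
  shows "near_absorbing (\<lambda>x. sum x I) N (boxbad a) (\<psi> u) (\<psi> v) (box I a)"
proof -
  note \<psi> = embedsD[OF assms(1)]
  show ?thesis
    by (rule near_absorbing_image[OF assms(2) \<psi>(2) _ _ _ _ \<psi>(3), where s = 0]) (use \<psi>(4-6) in simp_all)
qed

lemma embeds_id: "finite I \<Longrightarrow> embeds I a (\<lambda>x. sum x I) (boxbad a) (box I a) id"
  by (auto simp: embeds_def)

lemma absorbing_box_Un: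
  assumes "finite J" "finite I" "I \<inter> J = {}" "absorbing (\<lambda>x. sum x I) (sum a I) (boxbad a) (box I a)"
  shows "absorbing (\<lambda>x. sum x (I \<union> J)) (sum a (I \<union> J)) (boxbad a) (box (I \<union> J) a)"
  using assms
proof (induction J)
  case (insert i J)
  have "absorbing (\<lambda>x. sum x (insert i (I \<union> J))) (sum a (I \<union> J) + a i) (boxbad a) (box (insert i (I \<union> J)) a)"
    by (rule embeds_absorbing[OF embeds_prod[OF embeds_id] absorbing_prod]) (use insert in auto)
  then show ?case using insert by (simp add: add.commute)
qed simp

lemma near_absorbing_box_Un:
  assumes "finite J" "finite I" "I \<inter> J = {}" "\<And>j. j \<in> J \<Longrightarrow> a j \<noteq> 1"
    and "near_absorbing (\<lambda>x. sum x I) (sum a I) (boxbad a) (\<lambda>_. 0) (\<lambda>i. if i \<in> I then a i else 0) (box I a)"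
  shows "near_absorbing (\<lambda>x. sum x (I \<union> J)) (sum a (I \<union> J)) (boxbad a) (\<lambda>_. 0)
    (\<lambda>i. if i \<in> I \<union> J then a i else 0) (box (I \<union> J) a)"
  using assms
proof (induction J)
  case (insert i J)
  let ?t = "\<lambda>K i. if i \<in> K then a i else 0"
  have e: "embeds (insert i (I \<union> J)) a (prodrk (\<lambda>x. sum x (I \<union> J)) idrk) (prodbad (boxbad a) (fullbad (a i)))
      (box (I \<union> J) a \<times> {..a i}) (\<lambda>u. (id (fst u))(i := snd u))"
    by (rule embeds_prod[OF embeds_id]) (use insert in auto)
  have "near_absorbing (\<lambda>x. sum x (I \<union> J)) (sum a (I \<union> J)) (boxbad a) (\<lambda>_. 0) (?t (I \<union> J)) (box (I \<union> J) a)"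
    by (rule insert.IH) (use insert in auto)
  moreover have "a i \<noteq> 1" using insert.prems by blast
  ultimately
  have "near_absorbing (\<lambda>x. sum x (insert i (I \<union> J))) (sum a (I \<union> J) + a i) (boxbad a)
      ((\<lambda>_. 0)(i := 0)) ((?t (I \<union> J))(i := a i)) (box (insert i (I \<union> J)) a)"
    using embeds_near_absorbing[OF e near_absorbing_prod] by simp
  moreover have "(?t (I \<union> J))(i := a i) = ?t (insert i (I \<union> J))" by (auto simp: fun_eq_iff)
  moreover have "(\<lambda>_ :: nat. 0 :: nat)(i := 0) = (\<lambda>_. 0)" by (auto simp: fun_eq_iff)
  ultimately show ?case using insert by (simp add: add.commute)
qed simp

text \<open>The extra condition exempts a pair that moves every coordinate with
  \<open>a i \<noteq> 0\<close>, that is, the two endpoints of the box. Such a pair is left to the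
  goodness hypothesis.\<close>

definition partialbad :: "nat set \<Rightarrow> (nat \<Rightarrow> nat) \<Rightarrow> (nat \<Rightarrow> nat) \<Rightarrow> (nat \<Rightarrow> nat) \<Rightarrow> bool" where
  "partialbad I a x y \<longleftrightarrow> boxbad a x y \<and> (\<exists>i\<in>I. x i = y i \<and> a i \<noteq> 0)"

lemma absorbing_imp_partial:
  assumes "absorbing rk N (boxbad a) P"
  shows "sdec rk N (partialbad I a) P"
  by (rule sdec_image[OF absorbing_imp_sdec[OF assms], where \<phi> = id and s = 0])
     (auto simp: partialbad_def)

text \<open>The only possible bad pair of the long chain moves all coordinates in \<open>I\<close>
  with \<open>a i \<noteq> 0\<close>, so it is exempt.\<close>

lemma near_absorbing_imp_partial:
  assumes "near_absorbing rk N (boxbad a) (\<lambda>_. 0) (\<lambda>i. if i \<in> I then a i else 0) P"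
  shows "sdec rk N (partialbad I a) P"
proof -
  obtain D R where *: "P = D \<union> R" "D \<inter> R = {}" "saturated rk (\<lambda>_. 0) (\<lambda>i. if i \<in> I then a i else 0) D"
    "N = rk (\<lambda>_. 0) + rk (\<lambda>i. if i \<in> I then a i else 0)"
    "\<forall>x\<in>D. \<forall>y\<in>D. boxbad a x y \<longrightarrow> x = (\<lambda>_. 0) \<and> y = (\<lambda>i. if i \<in> I then a i else 0)"
    "absorbing rk N (boxbad a) R"
    using assms unfolding near_absorbing_def by blast
  have "\<forall>x\<in>D. \<forall>y\<in>D. \<not> partialbad I a x y"
    using *(5) unfolding partialbad_def by fastforce
  then have D: "sdec rk N (partialbad I a) D"
    using *(3,4) by (intro sdec_single) (auto simp: symchain_def)
  show ?thesis by (rule sdec_Un'[OF D absorbing_imp_partial[OF *(6)] *(2,1)])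
qed

text \<open>Adding coordinates through \<open>embeds_prod\<close> nests pairs to the left, whereas
  the cube was handled with pairs nested to the right.\<close>

lemma absorbing_cube5_nested:
  "absorbing (prodrk (prodrk (prodrk (prodrk idrk idrk) idrk) idrk) idrk) 5
    (prodbad (prodbad (prodbad (prodbad (fullbad 1) (fullbad 1)) (fullbad 1)) (fullbad 1)) (fullbad 1))
    ((((bit \<times> bit) \<times> bit) \<times> bit) \<times> bit)"
proof (rule absorbing_image[OF absorbing_cube5, where s = 0
      and \<phi> = "\<lambda>(x1, x2, x3, x4, x5). ((((x1, x2), x3), x4), x5)"])
  show "(((bit \<times> bit) \<times> bit) \<times> bit) \<times> bit =
    (\<lambda>(x1, x2, x3, x4, x5). ((((x1, x2), x3), x4), x5)) ` (bit \<times> bit \<times> bit \<times> bit \<times> bit)"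
  proof (intro equalityI subsetI)
    fix x assume "x \<in> (((bit \<times> bit) \<times> bit) \<times> bit) \<times> bit"
    then obtain x1 x2 x3 x4 x5 where "x = ((((x1, x2), x3), x4), x5)"
      "x1 \<in> bit" "x2 \<in> bit" "x3 \<in> bit" "x4 \<in> bit" "x5 \<in> bit" by blast
    then show "x \<in> (\<lambda>(x1, x2, x3, x4, x5). ((((x1, x2), x3), x4), x5)) ` (bit \<times> bit \<times> bit \<times> bit \<times> bit)"
      by (intro image_eqI[of _ _ "(x1, x2, x3, x4, x5)"]) simp_all
  qed auto
qed (auto simp: inj_on_def less_eq_prod_def prodbad_def fullbad_def)

lemma absorbing_box_ones:
  assumes "T \<subseteq> {i. a i = 1}" "card T = 5"
  shows "absorbing (\<lambda>x. sum x T) (sum a T) (boxbad a) (box T a)"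
proof -
  have fin: "finite T" using assms(2) card.infinite by fastforce
  obtain xs where xs: "set xs = T" "distinct xs" using finite_distinct_list[OF fin] by blast
  then have "length xs = 5" using assms(2) distinct_card by metis
  then obtain p q s t u where l: "xs = [p, q, s, t, u]"
    by (auto simp: eval_nat_numeral length_Suc_conv)
  have T: "T = insert u (insert t (insert s (insert q {p})))" using xs l by auto
  have d: "q \<notin> {p}" "s \<notin> insert q {p}" "t \<notin> insert s (insert q {p})" "u \<notin> insert t (insert s (insert q {p}))"
    using xs(2) unfolding l by auto
  have one: "a p = 1" "a q = 1" "a s = 1" "a t = 1" "a u = 1" using assms(1) unfolding T by auto
  note e = embeds_prod[OF embeds_prod[OF embeds_prod[OF embeds_prod[OF embeds_single[of p a] d(1)] d(2)] d(3)] d(4),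
    folded T, unfolded one]
  have "sum a T = 5" using assms by (simp add: subset_iff)
  then show ?thesis using embeds_absorbing[OF e absorbing_cube5_nested] by simp
qed

lemma absorbing_box_mono:
  assumes "finite I" "T \<subseteq> I" "absorbing (\<lambda>x. sum x T) (sum a T) (boxbad a) (box T a)"
  shows "absorbing (\<lambda>x. sum x I) (sum a I) (boxbad a) (box I a)"
proof -
  obtain J where J: "I = T \<union> J" "T \<inter> J = {}" using assms(2) by blast
  show ?thesis unfolding J(1)
    by (rule absorbing_box_Un) (use assms J in auto)
qed

lemma near_absorbing_box_mono:
  assumes "finite I" "T \<subseteq> I" "\<And>i. i \<in> I \<Longrightarrow> a i \<noteq> 1"
    and "near_absorbing (\<lambda>x. sum x T) (sum a T) (boxbad a) (\<lambda>_. 0) (\<lambda>i. if i \<in> T then a i else 0) (box T a)"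
  shows "near_absorbing (\<lambda>x. sum x I) (sum a I) (boxbad a) (\<lambda>_. 0) (\<lambda>i. if i \<in> I then a i else 0) (box I a)"
proof -
  obtain J where J: "I = T \<union> J" "T \<inter> J = {}" using assms(2) by blast
  show ?thesis unfolding J(1)
  proof (rule near_absorbing_box_Un)
    show "finite J" "finite T" using assms(1) J(1) by auto
    show "a j \<noteq> 1" if "j \<in> J" for j using assms(3) that J(1) by blast
  qed (fact J(2) assms(4))+
qed

text \<open>Six is the least number of odd sides that forces five sides equal to \<open>1\<close> or
  two odd sides of length at least \<open>3\<close>.\<close>

lemma sdec_box:
  assumes "finite I" "6 \<le> card {i\<in>I. odd (a i)}"
  shows "sdec (\<lambda>x. sum x I) (sum a I) (partialbad I a) (box I a)"
proof (cases "5 \<le> card {i\<in>I. a i = 1}")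
  case True
  from obtain_subset_with_card_n[OF this]
  obtain T where T: "T \<subseteq> {i\<in>I. a i = 1}" "card T = 5" by blast
  show ?thesis
    by (rule absorbing_imp_partial[OF absorbing_box_mono[OF assms(1) _ absorbing_box_ones[OF _ T(2)]]])
       (use T(1) in auto)
next
  case False
  have "{i\<in>I. odd (a i)} = {i\<in>I. a i = 1} \<union> {i\<in>I. odd (a i) \<and> a i \<noteq> 1}" by auto
  then have "6 \<le> card {i\<in>I. a i = 1} + card {i\<in>I. odd (a i) \<and> a i \<noteq> 1}"
    using assms(2) card_Un_le[of "{i\<in>I. a i = 1}" "{i\<in>I. odd (a i) \<and> a i \<noteq> 1}"] by simp
  then have "2 \<le> card {i\<in>I. odd (a i) \<and> a i \<noteq> 1}" using False by linarith
  from obtain_subset_with_card_n[OF this]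
  obtain U where U: "U \<subseteq> {i\<in>I. odd (a i) \<and> a i \<noteq> 1}" "card U = 2" by blast
  \<comment> \<open>The longer side comes first because the grid lemma needs its first side to be at
    least \<open>4\<close>.\<close>
  obtain p q where pq: "U = {p, q}" "p \<noteq> q" "a q \<le> a p"
  proof -
    obtain p q where "U = {p, q}" "p \<noteq> q" using U(2) by (auto simp: card_2_iff)
    then show thesis using that[of p q] that[of q p] by (cases "a q \<le> a p") auto
  qed
  have I: "p \<in> I" "q \<in> I" and od: "odd (a p)" "odd (a q)" "a p \<noteq> 1" "a q \<noteq> 1" using U(1) pq(1) by auto
  have q2: "2 \<le> a q" using od by presburger
  note e2 = embeds_prod[OF embeds_single[of p a], of q]
  show ?thesis
  \<comment> \<open>A side of length one is attached to the square right away: it makes the square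
    absorbing, after which arbitrary sides may follow. If there is no such side, the long chain can
    be carried along to the full box.\<close>
  proof (cases "\<exists>k\<in>I. a k = 1")
    case True
    then obtain k where k: "k \<in> I" "a k = 1" by blast
    have kn: "k \<notin> {q, p}" using k(2) od by auto
    have s: "sum a {k, q, p} = a p + a q + 1" using kn pq(2) k(2) by auto
    have "absorbing (\<lambda>x. sum x {k, q, p}) (sum a {k, q, p}) (boxbad a) (box {k, q, p} a)"
      unfolding s
      by (rule embeds_absorbing[OF embeds_prod[OF e2 kn]])
         (use absorbing_square_2[OF od(1,2) pq(3) q2] pq(2) k(2) in auto)
    from absorbing_imp_partial[OF absorbing_box_mono[OF assms(1) _ this]]
    show ?thesis using I k(1) by blast
  next
    case False
    have s: "sum a {q, p} = a p + a q" using pq(2) by simp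
    have z: "((\<lambda>_ :: nat. 0 :: nat)(p := 0))(q := 0) = (\<lambda>_. 0)"
      "((\<lambda>_ :: nat. 0 :: nat)(p := a p))(q := a q) = (\<lambda>i. if i \<in> {q, p} then a i else 0)"
      by (auto simp: fun_eq_iff)
    have "q \<notin> {p}" using pq(2) by simp
    from embeds_near_absorbing[OF e2[OF this] near_absorbing_square[OF od(1,2) pq(3) q2]]
    have "near_absorbing (\<lambda>x. sum x {q, p}) (sum a {q, p}) (boxbad a) (\<lambda>_. 0)
        (\<lambda>i. if i \<in> {q, p} then a i else 0) (box {q, p} a)"
      by (simp only: fst_conv snd_conv z s)
    from near_absorbing_imp_partial[OF near_absorbing_box_mono[OF assms(1) _ _ this]]
    show ?thesis using I False by blast
  qed
qed

section \<open>Transfer to the Boolean lattice\<close>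

text \<open>Writing \<open>n = 2 * m + a\<close> shows that \<open>a\<close> has the parity of
  \<open>n\<close>, which carries the oddness of the \<open>n i\<close> over to the sides of the
  boxes.\<close>

lemma symmetric_chain_param:
  assumes "symmetric_chain n C"
  shows "\<exists>f m a. n = 2 * m + a \<and> C = f ` {..a} \<and> (\<forall>x\<le>a. card (f x) = m + x) \<and>
    (\<forall>x y. x \<le> y \<longrightarrow> y \<le> a \<longrightarrow> f x \<subseteq> f y)"
proof -
  have "C \<subseteq> Pow {1..n} \<and> (\<forall>X\<in>C. \<forall>Y\<in>C. X \<subseteq> Y \<or> Y \<subseteq> X)"
    using assms by (simp add: symmetric_chain_def subset_chain_def boolean_lattice_def)
  then have ch: "C \<subseteq> Pow {1..n}" "\<forall>X\<in>C. \<forall>Y\<in>C. X \<subseteq> Y \<or> Y \<subseteq> X" by simp_all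
  obtain m where m: "2 * m \<le> n" "bij_betw card C {m..n - m}"
    using assms unfolding symmetric_chain_def by blast
  define f where "f x = inv_into C card (m + x)" for x
  have f: "f x \<in> C \<and> card (f x) = m + x" if "x \<le> n - 2 * m" for x
  proof -
    have "m + x \<in> card ` C" using m that by (auto simp: bij_betw_def)
    then show ?thesis unfolding f_def by (simp add: inv_into_into f_inv_into_f)
  qed
  have "X \<in> f ` {..n - 2 * m}" if "X \<in> C" for X
  proof (rule image_eqI)
    have c: "card X \<in> {m..n - m}" using m(2) that by (auto simp: bij_betw_def)
    then show "X = f (card X - m)" unfolding f_def using m(2) that by (simp add: bij_betw_def)
    show "card X - m \<in> {..n - 2 * m}" using c by auto
  qed
  then have "C = f ` {..n - 2 * m}" using f by auto
  moreover have "f x \<subseteq> f y" if "x \<le> y" "y \<le> n - 2 * m" for x y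
  proof (rule ccontr)
    assume n: "\<not> f x \<subseteq> f y"
    have xy: "f x \<in> C" "f y \<in> C" "card (f x) = m + x" "card (f y) = m + y"
      using f[of x] f[of y] that by simp_all
    have sub: "f y \<subseteq> f x" using ch(2) xy(1,2) n by blast
    have "finite (f x)" using xy(1) ch(1) finite_subset[of "f x" "{1..n}"] by blast
    then have "f y = f x" using sub xy(3,4) that card_mono[of "f x" "f y"] card_subset_eq[of "f x" "f y"] by simp
    then show False using n by simp
  qed
  moreover have "n = 2 * m + (n - 2 * m)" using m(1) by simp
  ultimately show ?thesis using f by blast
qed

lemma symmetric_chainI:
  assumes "symchain card n C" "C \<subseteq> Pow {1..n}"
  shows "symmetric_chain n C"
proof -
  obtain f a m where f: "C = f ` {..a}" "n = 2 * m + a" "\<forall>x\<le>a. card (f x) = m + x"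
    "\<forall>x y. x \<le> y \<longrightarrow> y \<le> a \<longrightarrow> f x \<subseteq> f y" using symchain_param[OF assms(1)] by blast
  have "X \<subseteq> Y \<or> Y \<subseteq> X" if XY: "X \<in> C" "Y \<in> C" for X Y
  proof -
    obtain x y where "X = f x" "Y = f y" "x \<le> a" "y \<le> a" using XY unfolding f(1) by blast
    then show ?thesis using f(4) by (cases "x \<le> y") auto
  qed
  then have "subset.chain (boolean_lattice n) C"
    using assms(2) by (auto simp: subset_chain_def boolean_lattice_def)
  moreover have "bij_betw card C {m..n - m}"
  proof (rule bij_betw_imageI)
    show "inj_on card C" unfolding f(1) using f(3) by (auto simp: inj_on_def)
    have "card ` C = (\<lambda>x. m + x) ` {..a}" unfolding f(1) image_image using f(3) by (intro image_cong) auto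
    also have "\<dots> = {m..n - m}"
      using image_add_atLeastAtMost[of m 0 a] f(2) by (simp add: atLeast0AtMost)
    finally show "card ` C = {m..n - m}" .
  qed
  ultimately show ?thesis unfolding symmetric_chain_def using f(2) by (intro conjI exI[of _ m]) auto
qed

section \<open>Subsets of consecutive blocks as tuples\<close>

context
  fixes n :: "nat \<Rightarrow> nat"
begin

definition offset :: "nat \<Rightarrow> nat" where
  "offset i = (\<Sum>l\<in>{1..<i}. n l)"

text \<open>Assembles a set from its blocks; on tuples of subsets of the blocks it is inverse to
  taking all the blocks.\<close>

definition glue :: "nat \<Rightarrow> (nat \<Rightarrow> nat set) \<Rightarrow> nat set" where
  "glue r Y = (\<Union>i\<in>{1..r}. (\<lambda>z. offset i + z) ` Y i)"

lemma offset_Suc: "1 \<le> i \<Longrightarrow> offset (Suc i) = offset i + n i"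
  by (simp add: offset_def)

lemma offset_last: "offset (Suc r) = (\<Sum>i\<in>{1..r}. n i)"
  by (simp add: offset_def atLeastLessThanSuc_atLeastAtMost)

lemma offset_mono:
  assumes "1 \<le> i" "i < j" shows "offset i + n i \<le> offset j"
proof -
  have "offset i + n i = offset (Suc i)" using offset_Suc assms(1) by simp
  also have "\<dots> \<le> offset j" unfolding offset_def using assms by (intro sum_mono2) auto
  finally show ?thesis .
qed

lemma offset_inj:
  assumes "offset i + z = offset j + w" "i \<in> {1..r}" "j \<in> {1..r}" "z \<in> {1..n i}" "w \<in> {1..n j}"
  shows "i = j \<and> z = w"
proof -
  have "\<not> i < j" using offset_mono[of i j] assms by auto
  moreover have "\<not> j < i" using offset_mono[of j i] assms by auto
  ultimately show ?thesis using assms(1) by simp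
qed

lemma offset_exists:
  "x \<in> {1..(\<Sum>i\<in>{1..r}. n i)} \<Longrightarrow> \<exists>i\<in>{1..r}. \<exists>z\<in>{1..n i}. x = offset i + z"
proof (induction r)
  case (Suc r)
  show ?case
  proof (cases "x \<le> (\<Sum>i\<in>{1..r}. n i)")
    case True
    then have "\<exists>i\<in>{1..r}. \<exists>z\<in>{1..n i}. x = offset i + z" using Suc by simp
    then show ?thesis by fastforce
  next
    case False
    have "x - offset (Suc r) \<in> {1..n (Suc r)}" "x = offset (Suc r) + (x - offset (Suc r))"
      using False Suc.prems offset_last[of r] by auto
    then show ?thesis by (intro bexI[of _ "Suc r"] bexI[of _ "x - offset (Suc r)"]) auto
  qed
qed simp

lemma offset_le:
  assumes "i \<in> {1..r}" "z \<in> {1..n i}"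
  shows "offset i + z \<in> {1..(\<Sum>i\<in>{1..r}. n i)}"
  using offset_mono[of i "Suc r"] offset_last[of r] assms by auto

lemma mem_block: "z \<in> block n i X \<longleftrightarrow> z \<in> {1..n i} \<and> offset i + z \<in> X"
  by (simp add: block_def offset_def)

lemma block_glue:
  assumes "\<And>i. i \<in> {1..r} \<Longrightarrow> Y i \<subseteq> {1..n i}" "i \<in> {1..r}"
  shows "block n i (glue r Y) = Y i"
proof (intro equalityI subsetI)
  fix z assume "z \<in> block n i (glue r Y)"
  then obtain j w where *: "z \<in> {1..n i}" "j \<in> {1..r}" "w \<in> Y j" "offset i + z = offset j + w"
    by (auto simp: mem_block glue_def)
  have "w \<in> {1..n j}" using assms(1)[OF *(2)] *(3) by blast
  then have "i = j \<and> z = w" using offset_inj[OF *(4) assms(2) *(2,1)] by blast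
  then show "z \<in> Y i" using *(3) by simp
next
  fix z assume z: "z \<in> Y i"
  then have "z \<in> {1..n i}" using assms by blast
  then show "z \<in> block n i (glue r Y)" using z assms(2) by (auto simp: mem_block glue_def)
qed

lemma glue_subset:
  assumes "\<And>i. i \<in> {1..r} \<Longrightarrow> Y i \<subseteq> {1..n i}"
  shows "glue r Y \<subseteq> {1..(\<Sum>i\<in>{1..r}. n i)}"
  unfolding glue_def using assms offset_le by blast

lemma glue_block:
  assumes "X \<subseteq> {1..(\<Sum>i\<in>{1..r}. n i)}"
  shows "glue r (\<lambda>i. block n i X) = X"
proof (intro equalityI subsetI)
  fix x assume "x \<in> X"
  then obtain i z where i: "i \<in> {1..r}" and "z \<in> {1..n i}" "x = offset i + z"
    using offset_exists assms by blast
  then have "x \<in> (\<lambda>z. offset i + z) ` block n i X" using \<open>x \<in> X\<close> by (simp add: mem_block)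
  then show "x \<in> glue r (\<lambda>i. block n i X)" unfolding glue_def using i by blast
qed (auto simp: glue_def mem_block)

lemma glue_mono: "(\<And>i. i \<in> {1..r} \<Longrightarrow> Y i \<subseteq> Z i) \<Longrightarrow> glue r Y \<subseteq> glue r Z"
  unfolding glue_def by blast

lemma card_glue:
  assumes "\<And>i. i \<in> {1..r} \<Longrightarrow> Y i \<subseteq> {1..n i}"
  shows "card (glue r Y) = (\<Sum>i\<in>{1..r}. card (Y i))"
proof -
  have "card (glue r Y) = (\<Sum>i\<in>{1..r}. card ((\<lambda>z. offset i + z) ` Y i))"
    unfolding glue_def
  proof (rule card_UN_disjoint)
    show "\<forall>i\<in>{1..r}. finite ((\<lambda>z. offset i + z) ` Y i)"
      using assms finite_subset by blast
    show "\<forall>i\<in>{1..r}. \<forall>j\<in>{1..r}. i \<noteq> j \<longrightarrow> (\<lambda>z. offset i + z) ` Y i \<inter> (\<lambda>z. offset j + z) ` Y j = {}"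
    proof (intro ballI impI)
      fix i j assume ij: "i \<in> {1..r}" "j \<in> {1..r}" "i \<noteq> j"
      have False if "z \<in> Y i" "w \<in> Y j" "offset i + z = offset j + w" for z w
        using offset_inj[of i z j w r] ij that assms by blast
      then show "(\<lambda>z. offset i + z) ` Y i \<inter> (\<lambda>z. offset j + z) ` Y j = {}" by auto
    qed
  qed simp
  also have "\<dots> = (\<Sum>i\<in>{1..r}. card (Y i))" by (intro sum.cong refl card_image) simp
  finally show ?thesis .
qed

lemma block_subset: "block n i X \<subseteq> {1..n i}"
  by (auto simp: mem_block)

lemma block_mono: "X \<subseteq> Y \<Longrightarrow> block n i X \<subseteq> block n i Y"
  by (auto simp: mem_block)

lemma block_eqD:
  assumes "X \<subseteq> {1..(\<Sum>i\<in>{1..r}. n i)}" "Y \<subseteq> {1..(\<Sum>i\<in>{1..r}. n i)}"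
    and "\<And>i. i \<in> {1..r} \<Longrightarrow> block n i X = block n i Y"
  shows "X = Y"
proof -
  have "glue r (\<lambda>i. block n i X) = glue r (\<lambda>i. block n i Y)"
    unfolding glue_def using assms(3) by simp
  then show ?thesis using glue_block[OF assms(1)] glue_block[OF assms(2)] by simp
qed

end

text \<open>The first disjunct confines a chain to a single cuboid.\<close>

definition tuplebad :: "nat \<Rightarrow> (nat \<Rightarrow> nat) \<Rightarrow> (nat \<Rightarrow> nat set set set) \<Rightarrow> nat set \<Rightarrow> nat set \<Rightarrow> bool" where
  "tuplebad r n \<F> X Y \<longleftrightarrow>
     (\<exists>i\<in>{1..r}. \<forall>C\<in>\<F> i. \<not> (block n i X \<in> C \<and> block n i Y \<in> C)) \<or>
     X \<noteq> Y \<and> (\<forall>i\<in>{1..r}. block n i X = block n i Y \<or> block n i X = {} \<and> block n i Y = {1..n i}) \<and>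
       (\<exists>i\<in>{1..r}. block n i X = block n i Y \<and> {block n i X} \<notin> \<F> i)"

text \<open>The parametrisations of the chains \<open>A i\<close> combine to a map from a box onto
  the cuboid. Since \<open>tuplebad\<close> refers to the families and not to the chosen
  \<open>A\<close>, the decompositions of different cuboids can be put together.\<close>

lemma sdec_cuboid:
  assumes n2: "\<And>i. i \<in> {1..r} \<Longrightarrow> n i \<ge> 2"
    and six: "card {i \<in> {1..r}. odd (n i)} \<ge> 6"
    and sym: "\<And>i. i \<in> {1..r} \<Longrightarrow> symmetric_chain (n i) (A i)"
    and A: "\<And>i. i \<in> {1..r} \<Longrightarrow> A i \<in> \<F> i"
  shows "sdec card (\<Sum>i\<in>{1..r}. n i) (tuplebad r n \<F>) (cuboid r n A)"
proof -
  let ?I = "{1..r}"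
  \<comment> \<open>The parametrisation, its lowest rank and its length are packed into one value so
    that a single choice over \<open>i\<close> suffices.\<close>
  have "\<exists>p. n i = 2 * fst (snd p) + snd (snd p) \<and> A i = fst p ` {..snd (snd p)} \<and>
     (\<forall>x\<le>snd (snd p). card (fst p x) = fst (snd p) + x) \<and>
     (\<forall>x y. x \<le> y \<longrightarrow> y \<le> snd (snd p) \<longrightarrow> fst p x \<subseteq> fst p y)" if i: "i \<in> ?I" for i
  proof -
    obtain f m a where "n i = 2 * m + a \<and> A i = f ` {..a} \<and> (\<forall>x\<le>a. card (f x) = m + x) \<and>
      (\<forall>x y. x \<le> y \<longrightarrow> y \<le> a \<longrightarrow> f x \<subseteq> f y)"
      using symmetric_chain_param[OF sym[OF i]] by blast
    then show ?thesis by (intro exI[of _ "(f, m, a)"]) simp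
  qed
  then have "\<exists>p. \<forall>i\<in>?I. n i = 2 * fst (snd (p i)) + snd (snd (p i)) \<and> A i = fst (p i) ` {..snd (snd (p i))} \<and>
     (\<forall>x\<le>snd (snd (p i)). card (fst (p i) x) = fst (snd (p i)) + x) \<and>
     (\<forall>x y. x \<le> y \<longrightarrow> y \<le> snd (snd (p i)) \<longrightarrow> fst (p i) x \<subseteq> fst (p i) y)"
    by (intro bchoice ballI)
  then obtain p where p: "\<forall>i\<in>?I. n i = 2 * fst (snd (p i)) + snd (snd (p i)) \<and> A i = fst (p i) ` {..snd (snd (p i))} \<and>
     (\<forall>x\<le>snd (snd (p i)). card (fst (p i) x) = fst (snd (p i)) + x) \<and>
     (\<forall>x y. x \<le> y \<longrightarrow> y \<le> snd (snd (p i)) \<longrightarrow> fst (p i) x \<subseteq> fst (p i) y)" by blast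
  define e where "e i = fst (p i)" for i
  define m where "m i = fst (snd (p i))" for i
  define a where "a i = snd (snd (p i))" for i
  have na: "n i = 2 * m i + a i" if "i \<in> ?I" for i
    using p that unfolding e_def m_def a_def by blast
  have Ae: "A i = e i ` {..a i}" if "i \<in> ?I" for i
    using p that unfolding e_def m_def a_def by blast
  have ce: "card (e i x) = m i + x" if "i \<in> ?I" "x \<le> a i" for i x
    using p that unfolding e_def m_def a_def by blast
  have me: "e i x \<subseteq> e i y" if "i \<in> ?I" "x \<le> y" "y \<le> a i" for i x y
    using p that unfolding e_def m_def a_def by blast
  have ie: "x = y" if "e i x = e i y" "i \<in> ?I" "x \<le> a i" "y \<le> a i" for i x y
    using arg_cong[OF that(1), of card] ce[OF that(2,3)] ce[OF that(2,4)] by linarith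
  define \<phi> where "\<phi> x = glue n r (\<lambda>i. e i (x i))" for x
  have sub: "e i (x i) \<subseteq> {1..n i}" if "x \<in> box ?I a" "i \<in> ?I" for x i
  proof -
    have "x i \<le> a i" using that by (simp add: box_def)
    then have "e i (x i) \<in> A i" unfolding Ae[OF that(2)] by blast
    moreover have "A i \<subseteq> Pow {1..n i}" using sym[OF that(2)]
      by (simp add: symmetric_chain_def subset_chain_def boolean_lattice_def)
    ultimately show ?thesis by blast
  qed
  have le: "x i \<le> a i" if "x \<in> box ?I a" "i \<in> ?I" for x i using that by (simp add: box_def)
  have bl: "block n i (\<phi> x) = e i (x i)" if "x \<in> box ?I a" "i \<in> ?I" for x i
    unfolding \<phi>_def by (rule block_glue[where r = r]) (use sub that in auto)
  have eqI: "x i = y i" if "x \<in> box ?I a" "y \<in> box ?I a" "i \<in> ?I" "block n i (\<phi> x) = block n i (\<phi> y)" for x y i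
    by (rule ie[OF _ that(3) le[OF that(1,3)] le[OF that(2,3)]])
       (use that(4) bl[OF that(1,3)] bl[OF that(2,3)] in simp)
  have "{i\<in>?I. odd (a i)} = {i\<in>?I. odd (n i)}" using na by auto
  then have "sdec (\<lambda>x. sum x ?I) (sum a ?I) (partialbad ?I a) (box ?I a)"
    using six by (intro sdec_box) auto
  then show ?thesis
  proof (rule sdec_image[where \<phi> = \<phi> and s = "sum m ?I"])
    show "inj_on \<phi> (box ?I a)"
    proof (intro inj_onI ext)
      fix x y i assume xy: "x \<in> box ?I a" "y \<in> box ?I a" "\<phi> x = \<phi> y"
      show "x i = y i"
      proof (cases "i \<in> ?I")
        case True then show ?thesis using eqI[OF xy(1,2)] xy(3) by simp
      next
        case False then show ?thesis using xy(1,2) by (simp add: box_def)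
      qed
    qed
    show "\<phi> x \<le> \<phi> y" if "x \<in> box ?I a" "y \<in> box ?I a" "x \<le> y" for x y
      unfolding \<phi>_def using that le[OF that(2)] by (intro glue_mono me) (auto simp: le_fun_def)
    show "card (\<phi> x) = sum x ?I + sum m ?I" if "x \<in> box ?I a" for x
    proof -
      have "card (\<phi> x) = (\<Sum>i\<in>?I. card (e i (x i)))"
        unfolding \<phi>_def by (rule card_glue) (use sub[OF that] in auto)
      also have "\<dots> = (\<Sum>i\<in>?I. m i + x i)" using ce le[OF that] by (intro sum.cong) auto
      finally show ?thesis by (simp add: sum.distrib)
    qed
    have "(\<Sum>i\<in>?I. n i) = (\<Sum>i\<in>?I. 2 * m i + a i)" using na by (intro sum.cong) auto
    then show "(\<Sum>i\<in>?I. n i) = sum a ?I + 2 * sum m ?I" by (simp add: sum.distrib sum_distrib_left)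
    show "cuboid r n A = \<phi> ` box ?I a"
    proof (intro equalityI subsetI)
      fix X assume X: "X \<in> cuboid r n A"
      define x where "x i = (if i \<in> ?I then inv_into {..a i} (e i) (block n i X) else 0)" for i
      have bX: "block n i X \<in> e i ` {..a i}" if "i \<in> ?I" for i
        unfolding Ae[OF that, symmetric] using X that by (simp add: cuboid_def)
      have ex: "e i (x i) = block n i X" if "i \<in> ?I" for i
        using f_inv_into_f[OF bX[OF that]] that by (simp add: x_def)
      have "x i \<le> a i" if "i \<in> ?I" for i
        using inv_into_into[OF bX[OF that]] that by (simp add: x_def)
      then have "x \<in> box ?I a" by (auto simp: box_def x_def)
      moreover have "\<phi> x = glue n r (\<lambda>i. block n i X)"
        unfolding \<phi>_def glue_def using ex by simp
      moreover have "\<dots> = X" using X by (intro glue_block) (simp add: cuboid_def boolean_lattice_def)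
      ultimately show "X \<in> \<phi> ` box ?I a" by blast
    next
      fix X assume "X \<in> \<phi> ` box ?I a"
      then obtain x where x: "x \<in> box ?I a" "X = \<phi> x" by blast
      have "\<phi> x \<subseteq> {1..(\<Sum>i\<in>?I. n i)}" unfolding \<phi>_def by (rule glue_subset) (use sub[OF x(1)] in auto)
      moreover have "block n i (\<phi> x) \<in> A i" if "i \<in> ?I" for i
        unfolding bl[OF x(1) that] Ae[OF that] using le[OF x(1) that] by blast
      ultimately show "X \<in> cuboid r n A" using x(2) by (simp add: cuboid_def boolean_lattice_def)
    qed
    show "partialbad ?I a x y" if xy: "x \<in> box ?I a" "y \<in> box ?I a" and bad: "tuplebad r n \<F> (\<phi> x) (\<phi> y)" for x y
    proof -
      have inA: "block n i (\<phi> x) \<in> A i \<and> block n i (\<phi> y) \<in> A i" if "i \<in> ?I" for i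
        unfolding bl[OF xy(1) that] bl[OF xy(2) that] Ae[OF that]
        using le[OF xy(1) that] le[OF xy(2) that] by blast
      then have "\<not> (\<exists>i\<in>{1..r}. \<forall>C\<in>\<F> i. \<not> (block n i (\<phi> x) \<in> C \<and> block n i (\<phi> y) \<in> C))"
        using A by blast
      then have b: "\<phi> x \<noteq> \<phi> y"
        "\<forall>i\<in>?I. block n i (\<phi> x) = block n i (\<phi> y) \<or> block n i (\<phi> x) = {} \<and> block n i (\<phi> y) = {1..n i}"
        "\<exists>i\<in>?I. block n i (\<phi> x) = block n i (\<phi> y) \<and> {block n i (\<phi> x)} \<notin> \<F> i"
        using bad unfolding tuplebad_def by blast+
      have "x i = y i \<or> 2 \<le> a i \<and> x i = 0 \<and> y i = a i" for i
      proof (cases "i \<in> ?I")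
        case True
        show ?thesis
        proof (cases "block n i (\<phi> x) = block n i (\<phi> y)")
          case False
          then have "block n i (\<phi> x) = {}" "block n i (\<phi> y) = {1..n i}"
            using bspec[OF b(2) True] by blast+
          then have "e i (x i) = {}" "e i (y i) = {1..n i}"
            by (simp_all only: bl[OF xy(1) True] bl[OF xy(2) True])
          \<comment> \<open>A chain that reaches both the empty set and the full block has
            \<open>m i = 0\<close>, hence \<open>a i = n i \<ge> 2\<close>, as \<open>boxbad\<close>
            demands.\<close>
          then have "m i + x i = 0" "m i + y i = n i"
            using ce[OF True le[OF xy(1) True]] ce[OF True le[OF xy(2) True]] by simp_all
          then show ?thesis using na[OF True] n2[OF True] by simp
        qed (use eqI[OF xy True] in simp)
      qed (use xy in \<open>simp add: box_def\<close>)
      then have "boxbad a x y" using b(1) by (auto simp: boxbad_def)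
      moreover obtain i where i: "i \<in> ?I" "block n i (\<phi> x) = block n i (\<phi> y)" "{block n i (\<phi> x)} \<notin> \<F> i"
        using b(3) by blast
      \<comment> \<open>Length zero would make \<open>A i\<close> a one-element chain of
        \<open>\<F> i\<close>, contrary to the last clause of \<open>tuplebad\<close>.\<close>
      have "a i \<noteq> 0"
      proof
        assume 0: "a i = 0"
        then have "A i = {e i 0}" "x i = 0" using Ae[OF i(1)] le[OF xy(1) i(1)] by auto
        then have "{block n i (\<phi> x)} = A i" using bl[OF xy(1) i(1)] by simp
        then show False using i(3) A[OF i(1)] by simp
      qed
      moreover have "x i = y i" using eqI[OF xy i(1,2)] .
      ultimately show ?thesis using i(1) by (auto simp: partialbad_def)
    qed
  qed
qed

lemma sdec_boolean_lattice:
  assumes "\<And>i. i \<in> {1..r} \<Longrightarrow> n i \<ge> 2"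
    and "card {i \<in> {1..r}. odd (n i)} \<ge> 6"
    and scd: "\<And>i. i \<in> {1..r} \<Longrightarrow> scd (n i) (\<F> i)"
  shows "sdec card (\<Sum>i\<in>{1..r}. n i) (tuplebad r n \<F>) (boolean_lattice (\<Sum>i\<in>{1..r}. n i))"
proof (rule sdec_partition)
  let ?I = "{1..r}" and ?N = "\<Sum>i\<in>{1..r}. n i"
  have part: "partition_on (Pow {1..n i}) (\<F> i)" if "i \<in> ?I" for i
    using scd[OF that] by (simp add: scd_def boolean_lattice_def)
  \<comment> \<open>With extensional choice functions, two different choices differ at an index in
    \<open>{1..r}\<close>, where their chains are disjoint.\<close>
  show "partition_on (boolean_lattice ?N) (cuboid r n ` (\<Pi>\<^sub>E i\<in>?I. \<F> i))"
  proof (rule partition_onI)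
    show "\<Union> (cuboid r n ` (\<Pi>\<^sub>E i\<in>?I. \<F> i)) = boolean_lattice ?N"
    proof (intro equalityI subsetI)
      fix X assume X: "X \<in> boolean_lattice ?N"
      have "\<exists>C. C \<in> \<F> i \<and> block n i X \<in> C" if "i \<in> ?I" for i
        using partition_onD1[OF part[OF that]] block_subset[of n i X] by blast
      then have "\<exists>A. \<forall>i\<in>?I. A i \<in> \<F> i \<and> block n i X \<in> A i" by (intro bchoice ballI)
      then obtain A where A: "\<forall>i\<in>?I. A i \<in> \<F> i \<and> block n i X \<in> A i" by blast
      then have "restrict A ?I \<in> (\<Pi>\<^sub>E i\<in>?I. \<F> i)" by auto
      moreover have "X \<in> cuboid r n (restrict A ?I)" using X A by (simp add: cuboid_def)
      ultimately show "X \<in> \<Union> (cuboid r n ` (\<Pi>\<^sub>E i\<in>?I. \<F> i))" by blast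
    qed (auto simp: cuboid_def)
    show "{} \<notin> cuboid r n ` (\<Pi>\<^sub>E i\<in>?I. \<F> i)"
    proof
      assume "{} \<in> cuboid r n ` (\<Pi>\<^sub>E i\<in>?I. \<F> i)"
      then obtain A where A: "A \<in> (\<Pi>\<^sub>E i\<in>?I. \<F> i)" "cuboid r n A = {}" by blast
      have ne: "A i \<noteq> {} \<and> A i \<subseteq> Pow {1..n i}" if "i \<in> ?I" for i
      proof
        have mem: "A i \<in> \<F> i" using PiE_mem[OF A(1) that] .
        then show "A i \<noteq> {}" using partition_onD3[OF part[OF that]] by metis
        show "A i \<subseteq> Pow {1..n i}" unfolding partition_onD1[OF part[OF that]] using mem by (rule Union_upper)
      qed
      then have "\<forall>i\<in>?I. \<exists>Z. Z \<in> A i" by blast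
      from bchoice[OF this] obtain Y where Y: "\<forall>i\<in>?I. Y i \<in> A i" by blast
      have sub: "Y i \<subseteq> {1..n i}" if "i \<in> ?I" for i using ne[OF that] Y that by blast
      have "glue n r Y \<in> cuboid r n A"
        using glue_subset[OF sub] block_glue[OF sub] Y by (simp add: cuboid_def boolean_lattice_def)
      then show False using A(2) by simp
    qed
    fix P Q assume "P \<in> cuboid r n ` (\<Pi>\<^sub>E i\<in>?I. \<F> i)" "Q \<in> cuboid r n ` (\<Pi>\<^sub>E i\<in>?I. \<F> i)" "P \<noteq> Q"
    then obtain A A' where A: "A \<in> (\<Pi>\<^sub>E i\<in>?I. \<F> i)" "A' \<in> (\<Pi>\<^sub>E i\<in>?I. \<F> i)"
      "P = cuboid r n A" "Q = cuboid r n A'" "A \<noteq> A'" by blast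
    obtain i where i: "i \<in> ?I" "A i \<noteq> A' i" using PiE_ext[OF A(1,2)] A(5) by blast
    then have "A i \<inter> A' i = {}"
      using disjointD[OF partition_onD2[OF part[OF i(1)]]] PiE_mem[OF A(1) i(1)] PiE_mem[OF A(2) i(1)] by blast
    then show "disjnt P Q" unfolding A(3,4) cuboid_def disjnt_def using i(1) by blast
  qed
  fix Q assume "Q \<in> cuboid r n ` (\<Pi>\<^sub>E i\<in>?I. \<F> i)"
  then obtain A where A: "A \<in> (\<Pi>\<^sub>E i\<in>?I. \<F> i)" "Q = cuboid r n A" by blast
  have mem: "A i \<in> \<F> i" if "i \<in> ?I" for i using PiE_mem[OF A(1) that] .
  show "sdec card ?N (tuplebad r n \<F>) Q" unfolding A(2)
  proof (rule sdec_cuboid)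
    show "symmetric_chain (n i) (A i)" if "i \<in> ?I" for i
      using scd[OF that] mem[OF that] by (simp add: scd_def)
  qed (fact assms(1,2) mem)+
qed

section \<open>Almost orthogonality of the resulting decompositions\<close>

lemma even_singleton:
  assumes "symmetric_chain n {x}" shows "even n"
proof -
  obtain j where "2 * j \<le> n" "bij_betw card {x} {j..n - j}"
    using assms unfolding symmetric_chain_def by blast
  then have "card {j..n - j} = 1" using bij_betw_same_card[of card "{x}"] by fastforce
  then have "n = 2 * j" using \<open>2 * j \<le> n\<close> by simp
  then show ?thesis by simp
qed

text \<open>Two common points leave only the exceptional case of almost orthogonality, and there the
  intersection has no room for anything besides \<open>{}\<close> and \<open>{1..n}\<close>.\<close>

lemma almost_orthogonal_endpoints:
  assumes "almost_orthogonal n \<F> \<G>" "A \<in> \<F>" "B \<in> \<G>" "A \<subseteq> Pow {1..n}" "n \<ge> 1"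
    and "X \<in> A \<inter> B" "Y \<in> A \<inter> B" "X \<subset> Y"
  shows "X = {} \<and> Y = {1..n}"
proof -
  have fin: "finite (A \<inter> B)" using assms(4) finite_subset[of "A \<inter> B" "Pow {1..n}"] by auto
  have "card {X, Y} \<le> card (A \<inter> B)" using assms(6,7) by (intro card_mono fin) auto
  then have c: "2 \<le> card (A \<inter> B)" using assms(8) by auto
  have o: "if {} \<in> A \<and> {1..n} \<in> A \<and> {} \<in> B \<and> {1..n} \<in> B then card (A \<inter> B) = 2 else card (A \<inter> B) \<le> 1"
    using assms(1-3) unfolding almost_orthogonal_def by blast
  then have top: "{} \<in> A \<and> {1..n} \<in> A \<and> {} \<in> B \<and> {1..n} \<in> B" and c2: "card (A \<inter> B) = 2"
    using c by (auto split: if_splits)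
  have "{{}, {1..n}} = A \<inter> B"
    using top c2 assms(5) by (intro card_subset_eq fin) auto
  then have "X \<in> {{}, {1..n}}" "Y \<in> {{}, {1..n}}" using assms(6,7) by simp_all
  then show ?thesis using assms(8) by auto
qed

theorem theorem3p4:
  fixes k r :: nat and n :: "nat \<Rightarrow> nat"
    and F :: "nat \<Rightarrow> nat \<Rightarrow> nat set set set"
  assumes "k \<ge> 3"
    and "\<And>i. i \<in> {1..r} \<Longrightarrow> n i \<ge> 2"
    and "card {i \<in> {1..r}. odd (n i)} \<ge> 6"
    and "\<And>i. i \<in> {1..r} \<Longrightarrow> pairwise_almost_orthogonal_scds (n i) k (F i)"
    and "\<And>i. i \<in> {1..r} \<Longrightarrow> even (n i) \<Longrightarrow> good k (F i)"
  shows "\<exists>H. pairwise_almost_orthogonal_scds (\<Sum>i\<in>{1..r}. n i) k H \<and>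
           (\<forall>j\<in>{1..k}. \<forall>C\<in>H j. \<exists>A. (\<forall>i\<in>{1..r}. A i \<in> F i j) \<and> C \<subseteq> cuboid r n A)"
proof -
  let ?I = "{1..r}" and ?N = "\<Sum>i\<in>{1..r}. n i"
  have scd: "scd (n i) (F i j)" if "i \<in> ?I" "j \<in> {1..k}" for i j
    using assms(4)[OF that(1)] that(2) by (simp add: pairwise_almost_orthogonal_scds_def)
  have "\<exists>\<C>. partition_on (boolean_lattice ?N) \<C> \<and>
     (\<forall>C\<in>\<C>. symchain card ?N C \<and> (\<forall>X\<in>C. \<forall>Y\<in>C. \<not> tuplebad r n (\<lambda>i. F i j) X Y))"
    if j: "j \<in> {1..k}" for j
    using sdec_boolean_lattice[of r n "\<lambda>i. F i j", OF assms(2,3) scd[OF _ j]]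
    unfolding sdec_def by blast
  then have "\<exists>H. \<forall>j\<in>{1..k}. partition_on (boolean_lattice ?N) (H j) \<and>
     (\<forall>C\<in>H j. symchain card ?N C \<and> (\<forall>X\<in>C. \<forall>Y\<in>C. \<not> tuplebad r n (\<lambda>i. F i j) X Y))"
    by (intro bchoice ballI)
  then obtain H where H: "\<forall>j\<in>{1..k}. partition_on (boolean_lattice ?N) (H j) \<and>
     (\<forall>C\<in>H j. symchain card ?N C \<and> (\<forall>X\<in>C. \<forall>Y\<in>C. \<not> tuplebad r n (\<lambda>i. F i j) X Y))" by blast
  have Hp: "partition_on (boolean_lattice ?N) (H j)" if "j \<in> {1..k}" for j using H that by blast
  have Hs: "symchain card ?N C" if "j \<in> {1..k}" "C \<in> H j" for j C using H that by blast
  have Hb: "\<not> tuplebad r n (\<lambda>i. F i j) X Y" if "j \<in> {1..k}" "C \<in> H j" "X \<in> C" "Y \<in> C" for j C X Y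
    using H that by blast
  have Hsub: "C \<subseteq> Pow {1..?N}" if "j \<in> {1..k}" "C \<in> H j" for j C
    using partition_onD1[OF Hp[OF that(1)]] that(2) by (auto simp: boolean_lattice_def)
  have Hc: "symmetric_chain ?N C" if "j \<in> {1..k}" "C \<in> H j" for j C
    by (rule symmetric_chainI[OF Hs[OF that] Hsub[OF that]])
  have Hcub: "\<exists>A\<in>F i j. block n i X \<in> A \<and> block n i Y \<in> A"
    if "j \<in> {1..k}" "C \<in> H j" "X \<in> C" "Y \<in> C" "i \<in> ?I" for i j C X Y
    using Hb[OF that(1-4)] that(5) unfolding tuplebad_def by blast
  \<comment> \<open>Almost orthogonality of the factors makes \<open>X\<close> and \<open>Y\<close>
    agree or run from bottom to top in each block; goodness and the absence of bad pairs then rule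
    out agreement in any block.\<close>
  have ends: "X = {} \<and> Y = {1..?N}"
    if j: "j \<in> {1..k}" "j' \<in> {1..k}" "j \<noteq> j'" and CD: "C \<in> H j" "D \<in> H j'"
      and XY: "X \<in> C" "X \<in> D" "Y \<in> C" "Y \<in> D" "X \<subset> Y" for j j' C D X Y
  proof -
    have b: "block n i X = block n i Y \<or> block n i X = {} \<and> block n i Y = {1..n i}" if i: "i \<in> ?I" for i
    proof (cases "block n i X = block n i Y")
      case False
      then have lt: "block n i X \<subset> block n i Y" using block_mono[of X Y n i] XY(5) by blast
      obtain A where A: "A \<in> F i j" "block n i X \<in> A" "block n i Y \<in> A"
        using Hcub[OF j(1) CD(1) XY(1,3) i] by blast
      obtain B where B: "B \<in> F i j'" "block n i X \<in> B" "block n i Y \<in> B"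
        using Hcub[OF j(2) CD(2) XY(2,4) i] by blast
      have "almost_orthogonal (n i) (F i j) (F i j')"
        using assms(4)[OF i] j unfolding pairwise_almost_orthogonal_scds_def by (auto dest: pairwiseD)
      moreover have "A \<subseteq> Pow {1..n i}"
        using scd[OF i j(1)] A(1) by (auto simp: scd_def partition_on_def boolean_lattice_def)
      moreover have "n i \<ge> 1" using assms(2)[OF i] by simp
      ultimately show ?thesis
        using almost_orthogonal_endpoints[of "n i" "F i j" "F i j'" A B] A B lt by blast
    qed simp
    have diff: "block n i X \<noteq> block n i Y" if i: "i \<in> ?I" for i
    proof
      assume eq: "block n i X = block n i Y"
      have "X \<noteq> Y" using XY(5) by blast
      \<comment> \<open>If the blocks agree at \<open>i\<close> without forming a one-element chain
        of the family, the pair is bad. Applied to both \<open>C\<close> and \<open>D\<close>, this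
        puts the same one-element chain into both families.\<close>
      then have s: "{block n i X} \<in> F i j" "{block n i X} \<in> F i j'"
        using Hb[OF j(1) CD(1) XY(1,3)] Hb[OF j(2) CD(2) XY(2,4)] b i eq unfolding tuplebad_def by blast+
      \<comment> \<open>A one-element symmetric chain forces \<open>n i\<close> to be even, so
        goodness becomes available.\<close>
      have "symmetric_chain (n i) {block n i X}" using scd[OF i j(1)] s(1) by (simp add: scd_def)
      then have "good k (F i)" using even_singleton assms(5)[OF i] by blast
      then have "\<not> (\<exists>A. card A = 1 \<and> A \<in> F i j \<and> A \<in> F i j')"
        using j unfolding good_def by (auto dest: pairwiseD)
      then show False using s by (metis card_1_singleton_iff One_nat_def)
    qed
    have sub: "X \<subseteq> {1..?N}" "Y \<subseteq> {1..?N}" using Hsub[OF j(1) CD(1)] XY by auto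
    have "X = {}"
    proof (rule block_eqD[OF sub(1)])
      show "block n i X = block n i {}" if "i \<in> ?I" for i
        using b[OF that] diff[OF that] by (simp add: block_def)
    qed simp
    moreover have "Y = {1..?N}"
    proof (rule block_eqD[OF sub(2)])
      show "block n i Y = block n i {1..?N}" if "i \<in> ?I" for i
        using b[OF that] diff[OF that] offset_le[of i r _ n] that by (auto simp: mem_block)
    qed simp
    ultimately show ?thesis by blast
  qed
  \<comment> \<open>The ground set has to be nonempty for \<open>{{}, {1..?N}}\<close> to have two
    elements.\<close>
  have "?I \<noteq> {}" using assms(3) by (metis (no_types, lifting) Collect_empty_eq card.empty empty_iff not_numeral_le_zero)
  then have "1 \<in> ?I" by simp
  then have "n 1 \<le> ?N" by (intro member_le_sum) auto
  then have N: "{} \<noteq> {1..?N}" using assms(2)[OF \<open>1 \<in> ?I\<close>] by simp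
  have ortho: "almost_orthogonal ?N (H j) (H j')" if j: "j \<in> {1..k}" "j' \<in> {1..k}" "j \<noteq> j'" for j j'
    unfolding almost_orthogonal_def
  proof (intro ballI)
    fix C D assume CD: "C \<in> H j" "D \<in> H j'"
    have comp: "X \<subset> Y \<or> Y \<subset> X" if "X \<in> C \<inter> D" "Y \<in> C \<inter> D" "X \<noteq> Y" for X Y
      using Hc[OF j(1) CD(1)] that unfolding symmetric_chain_def subset_chain_def by blast
    have E: "X = {} \<and> Y = {1..?N} \<or> Y = {} \<and> X = {1..?N}"
      if "X \<in> C \<inter> D" "Y \<in> C \<inter> D" "X \<noteq> Y" for X Y
      using comp[OF that] ends[OF j CD, of X Y] ends[OF j CD, of Y X] that by blast
    show "if {} \<in> C \<and> {1..?N} \<in> C \<and> {} \<in> D \<and> {1..?N} \<in> D then card (C \<inter> D) = 2 else card (C \<inter> D) \<le> 1"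
    proof (cases "{} \<in> C \<and> {1..?N} \<in> C \<and> {} \<in> D \<and> {1..?N} \<in> D")
      case True
      have "C \<inter> D = {{}, {1..?N}}"
      proof
        show "C \<inter> D \<subseteq> {{}, {1..?N}}"
        proof
          fix Z assume "Z \<in> C \<inter> D"
          then show "Z \<in> {{}, {1..?N}}" using E[of "{}" Z] True by blast
        qed
      qed (use True in blast)
      then show ?thesis using True N by simp
    next
      case False
      have "X = Y" if "X \<in> C \<inter> D" "Y \<in> C \<inter> D" for X Y
        using E[OF that] False that by blast
      then have "card (C \<inter> D) \<le> 1"
        by (metis card_le_Suc0_iff_eq card.infinite One_nat_def zero_le)
      then show ?thesis using False by simp
    qed
  qed
  have "pairwise_almost_orthogonal_scds ?N k H"
    unfolding pairwise_almost_orthogonal_scds_def scd_def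
    using Hp Hc ortho by (auto simp: pairwise_def)
  moreover have "\<exists>A. (\<forall>i\<in>?I. A i \<in> F i j) \<and> C \<subseteq> cuboid r n A" if j: "j \<in> {1..k}" and C: "C \<in> H j" for j C
  proof -
    \<comment> \<open>The cuboid is read off from one point of \<open>C\<close>. Any other point
      shares a chain with it in every block, and as the chains of a family are disjoint, it is the
      same chain.\<close>
    obtain X where X: "X \<in> C" using partition_onD3[OF Hp[OF j]] C by (metis ex_in_conv)
    have "\<exists>A. A \<in> F i j \<and> block n i X \<in> A" if "i \<in> ?I" for i
      using Hcub[OF j C X X that] by blast
    then have "\<exists>A. \<forall>i\<in>?I. A i \<in> F i j \<and> block n i X \<in> A i" by (intro bchoice ballI)
    then obtain A where A: "\<forall>i\<in>?I. A i \<in> F i j \<and> block n i X \<in> A i" by blast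
    have "block n i Y \<in> A i" if Y: "Y \<in> C" and i: "i \<in> ?I" for Y i
    proof -
      obtain B where B: "B \<in> F i j" "block n i X \<in> B" "block n i Y \<in> B"
        using Hcub[OF j C X Y i] by blast
      have "disjoint (F i j)" using scd[OF i j] by (simp add: scd_def partition_on_def)
      then have "B = A i" using B A i disjointD[of "F i j" B "A i"] by blast
      then show ?thesis using B by simp
    qed
    then have "C \<subseteq> cuboid r n A"
      using Hsub[OF j C] by (auto simp: cuboid_def boolean_lattice_def)
    then show ?thesis using A by blast
  qed
  ultimately show ?thesis by blast
qed

end
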